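(* Let $\Omega$ be an open subset of $\mathbb{R}^d$ and let $c_{ij}=c_{ji}\in W^{1,\infty}(\Omega)$, $1\le i,j\le d$, be real with $C(x)=(c_{ij}(x))$ strictly positive-definite for all $x\in\Omega$. Let $A$ be a measurable subset of $\overline\Omega$ with Lebesgue measure $|A|=0$. Assume there are $a>0$ and $\gamma\ge0$ such that $0<C(x)\le a\,(d_A(x)\wedge1)^\gamma I$ for all $x\in\Omega$, where $d_A$ is the Euclidean distance to $A$. If $\gamma\ge2-(d-d(A))$ then $\mathrm{cap}_\Omega(A)=0$. In particular $\mathrm{cap}_\Omega(A)=0$ for all such $A$ with $d(A)\le d-2$.
   Context: Functions are real-valued, $\partial_i=\partial/\partial x_i$, $s\wedge t=\min(s,t)$, and the matrix inequality is in the sense of quadratic forms. The form $l_\Omega$ is defined by $l_\Omega(\varphi)=\int_\Omega dx\sum_{i,j=1}^d c_{ij}(x)(\partial_i\varphi)(x)(\partial_j\varphi)(x)$, where $\partial_i\varphi$ are distributional derivatives and $D(l_\Omega)$ is the set of all $\varphi\in L_2(\Omega)$ for which the integral is finite; $\|\varphi\|_{D(l_\Omega)}=(l_\Omega(\varphi)+\|\varphi\|_2^2)^{1/2}$. The (relative) capacity of a measurable subset $A\subset\overline\Omega$ is $$\mathrm{cap}_\Omega(A)=\inf\{\|\psi\|_{D(l_\Omega)}^2:\psi\in D(l_\Omega)\text{ and there exists an open set }U\subset\mathbb{R}^d\text{ with }U\supseteq A\text{ and }\psi=1\text{ a.e. on }U\cap\Omega\}.$$ For a bounded measurable set $B\subseteq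 A$ and $\delta>0$ let $B_\delta=\{x\in\mathbb{R}^d:\inf_{y\in B}|x-y|<\delta\}$. The Minkowski dimension $d(B)$ of $B$ is the smallest non-negative real value for which there is a $b>0$ such that $|B_\delta|\le b\,\delta^{d-d(B)}$ for all $\delta\in(0,1]$. The dimension of $A$ is $d(A)=\sup\{d(B):B\subseteq A\}$, the supremum over bounded measurable subsets $B$ of $A$. (In the "in particular" assertion no degeneracy of the coefficients on $A$ is required, i.e. $\gamma=0$ is allowed.)
   Formalization: The smallest exponent defining d(B) may not exist, so d(B) is taken as an infimum; in the equality cases γ=2-(d-d(A)) and d(A)=d-2 the minimum is assumed to exist for bounded measurable B in A with d(B)=d(A). *)

theory Defs
  imports "HOL-Analysis.Analysis"
begin

text \<open>
  Functions on an open set \<open>\<Omega>\<close> are represented by total functions on \<open>real ^ 'n\<close> whose values outside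
  \<open>\<Omega>\<close> are irrelevant; the dimension \<open>d\<close> is \<open>CARD('n)\<close>.
\<close>

subsection \<open>Distributional derivatives\<close>

definition partial_deriv :: "'n::finite \<Rightarrow> (real ^ 'n \<Rightarrow> real) \<Rightarrow> real ^ 'n \<Rightarrow> real" where
  "partial_deriv i f x = frechet_derivative f (at x) (axis i 1)"

primrec Ck :: "nat \<Rightarrow> (real ^ 'n::finite \<Rightarrow> real) \<Rightarrow> bool" where
  "Ck 0 f \<longleftrightarrow> continuous_on UNIV f"
| "Ck (Suc k) f \<longleftrightarrow> (\<forall>x. f differentiable (at x)) \<and> (\<forall>i. Ck k (partial_deriv i f))"

definition test_function :: "(real ^ 'n::finite) set \<Rightarrow> (real ^ 'n \<Rightarrow> real) \<Rightarrow> bool" where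
  "test_function \<Omega> \<eta> \<longleftrightarrow>
     (\<forall>k. Ck k \<eta>) \<and> compact (closure {x. \<eta> x \<noteq> 0}) \<and> closure {x. \<eta> x \<noteq> 0} \<subseteq> \<Omega>"

definition locally_integrable :: "(real ^ 'n::finite) set \<Rightarrow> (real ^ 'n \<Rightarrow> real) \<Rightarrow> bool" where
  "locally_integrable \<Omega> f \<longleftrightarrow> (\<forall>K. compact K \<and> K \<subseteq> \<Omega> \<longrightarrow> set_integrable lebesgue K f)"

definition has_weak_partial ::
    "(real ^ 'n::finite) set \<Rightarrow> 'n \<Rightarrow> (real ^ 'n \<Rightarrow> real) \<Rightarrow> (real ^ 'n \<Rightarrow> real) \<Rightarrow> bool" where
  "has_weak_partial \<Omega> i f g \<longleftrightarrow>
     locally_integrable \<Omega> f \<and> locally_integrable \<Omega> g \<and>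
     (\<forall>\<eta>. test_function \<Omega> \<eta> \<longrightarrow>
        (LINT x:\<Omega>|lebesgue. f x * partial_deriv i \<eta> x) = - (LINT x:\<Omega>|lebesgue. g x * \<eta> x))"

definition has_weak_gradient ::
    "(real ^ 'n::finite) set \<Rightarrow> (real ^ 'n \<Rightarrow> real) \<Rightarrow> (real ^ 'n \<Rightarrow> real ^ 'n) \<Rightarrow> bool" where
  "has_weak_gradient \<Omega> f G \<longleftrightarrow> (\<forall>i. has_weak_partial \<Omega> i f (\<lambda>x. G x $ i))"

definition L_infinity :: "(real ^ 'n::finite) set \<Rightarrow> (real ^ 'n \<Rightarrow> real) set" where
  "L_infinity \<Omega> = {f. set_borel_measurable lebesgue \<Omega> f \<and>
     (\<exists>M. AE x in lebesgue. x \<in> \<Omega> \<longrightarrow> \<bar>f x\<bar> \<le> M)}"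

definition W1_infinity :: "(real ^ 'n::finite) set \<Rightarrow> (real ^ 'n \<Rightarrow> real) set" where
  "W1_infinity \<Omega> = {f \<in> L_infinity \<Omega>. \<forall>i. \<exists>g \<in> L_infinity \<Omega>. has_weak_partial \<Omega> i f g}"

subsection \<open>The form and the relative capacity\<close>

definition L2_norm_sq :: "(real ^ 'n::finite) set \<Rightarrow> (real ^ 'n \<Rightarrow> real) \<Rightarrow> ennreal" where
  "L2_norm_sq \<Omega> f = (\<integral>\<^sup>+x\<in>\<Omega>. ennreal ((f x)\<^sup>2) \<partial>lebesgue)"

definition L2_space :: "(real ^ 'n::finite) set \<Rightarrow> (real ^ 'n \<Rightarrow> real) set" where
  "L2_space \<Omega> = {f. set_borel_measurable lebesgue \<Omega> f \<and> L2_norm_sq \<Omega> f < \<infinity>}"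

text \<open>
  A distributional gradient \<open>G\<close> of \<open>\<phi>\<close> is unique up to a null set of \<open>\<Omega>\<close>, so all \<open>G\<close> below give
  the same integral: the infimum only turns this at most single-valued expression into a total
  function, with value \<open>\<infinity>\<close> if the distributional derivatives of \<open>\<phi>\<close> are not functions.
  For positive semi-definite \<open>C x\<close> the integrand is nonnegative, so \<open>ennreal\<close> does not truncate it.
\<close>

definition l_form ::
    "(real ^ 'n::finite) set \<Rightarrow> (real ^ 'n \<Rightarrow> real ^ 'n ^ 'n) \<Rightarrow> (real ^ 'n \<Rightarrow> real) \<Rightarrow> ennreal" where
  "l_form \<Omega> C \<phi> = (INF G \<in> {G. has_weak_gradient \<Omega> \<phi> G}.
     \<integral>\<^sup>+x\<in>\<Omega>. ennreal (\<Sum>i\<in>UNIV. \<Sum>j\<in>UNIV. C x $ i $ j * G x $ i * G x $ j) \<partial>lebesgue)"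

definition l_domain ::
    "(real ^ 'n::finite) set \<Rightarrow> (real ^ 'n \<Rightarrow> real ^ 'n ^ 'n) \<Rightarrow> (real ^ 'n \<Rightarrow> real) set" where
  "l_domain \<Omega> C = {\<phi> \<in> L2_space \<Omega>. l_form \<Omega> C \<phi> < \<infinity>}"

definition cap ::
    "(real ^ 'n::finite) set \<Rightarrow> (real ^ 'n \<Rightarrow> real ^ 'n ^ 'n) \<Rightarrow> (real ^ 'n) set \<Rightarrow> ennreal" where
  "cap \<Omega> C A = (INF \<psi> \<in> {\<psi> \<in> l_domain \<Omega> C.
       \<exists>U. open U \<and> A \<subseteq> U \<and> (AE x in lebesgue. x \<in> U \<inter> \<Omega> \<longrightarrow> \<psi> x = 1)}.
     l_form \<Omega> C \<psi> + L2_norm_sq \<Omega> \<psi>)"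

subsection \<open>Dimension\<close>

definition nbhd :: "(real ^ 'n::finite) set \<Rightarrow> real \<Rightarrow> (real ^ 'n) set" where
  "nbhd B \<delta> = {x. B \<noteq> {} \<and> infdist x B < \<delta>}"

definition minkowski_exponents :: "(real ^ 'n::finite) set \<Rightarrow> real set" where
  "minkowski_exponents B = {s. 0 \<le> s \<and>
     (\<exists>b>0. \<forall>\<delta>\<in>{0<..1}. measure lebesgue (nbhd B \<delta>) \<le> b * \<delta> powr (real CARD('n) - s))}"

text \<open>
  The Minkowski dimension is the smallest element of \<open>minkowski_exponents B\<close>. The infimum agrees
  with it whenever a smallest element exists, which may fail: if the volume of the
  \<open>\<delta>\<close>-neighbourhood behaves like \<open>\<delta> powr (d - s) * ln (1 / \<delta>)\<close>, then the infimum is \<open>s\<close> but \<open>s\<close>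
  is not an element. The existence of the minimum is therefore expressed separately, by
  \<open>dimension_attained\<close>, and only for those bounded subsets whose dimension is the full dimension
  of \<open>A\<close>. For bounded \<open>B\<close> the set of exponents contains \<open>d\<close>, so the infimum and the supremum below
  are taken over nonempty sets bounded by \<open>0\<close> and \<open>d\<close>.
\<close>

definition minkowski_dim :: "(real ^ 'n::finite) set \<Rightarrow> real" where
  "minkowski_dim B = Inf (minkowski_exponents B)"

definition bounded_measurable_subsets :: "(real ^ 'n::finite) set \<Rightarrow> (real ^ 'n) set set" where
  "bounded_measurable_subsets A = {B. B \<subseteq> A \<and> bounded B \<and> B \<in> sets lebesgue}"

definition set_dimension :: "(real ^ 'n::finite) set \<Rightarrow> real" where
  "set_dimension A = (SUP B \<in> bounded_measurable_subsets A. minkowski_dim B)"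

definition dimension_attained :: "(real ^ 'n::finite) set \<Rightarrow> bool" where
  "dimension_attained A \<longleftrightarrow> (\<forall>B \<in> bounded_measurable_subsets A.
     minkowski_dim B = set_dimension A \<longrightarrow> minkowski_dim B \<in> minkowski_exponents B)"

subsection \<open>Degeneracy of the coefficients\<close>

text \<open>
  The value of \<open>(min (d\<^sub>A x) 1) ^ \<gamma>\<close> with the usual conventions that the distance to the empty set is
  infinite and that the zeroth power of zero is one (while \<open>infdist x {} = 0\<close> and \<open>0 powr 0 = 0\<close>).
\<close>

definition degeneracy_weight :: "(real ^ 'n::finite) set \<Rightarrow> real \<Rightarrow> real ^ 'n \<Rightarrow> real" where
  "degeneracy_weight A \<gamma> x =
     (if A = {} \<or> \<gamma> = 0 then 1 else min (infdist x A) 1 powr \<gamma>)"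

end

theory Submission
  imports Defs
begin

text \<open>
  The capacity vanishes as soon as there are differentiable functions that equal \<open>1\<close> near \<open>A\<close>
  and have arbitrarily small energy \<open>\<integral> w |\<nabla>\<psi>|\<^sup>2 + \<psi>\<^sup>2\<close> over \<open>\<Omega>\<close>, where \<open>w\<close> is the degeneracy weight
  that bounds the coefficients up to the factor \<open>a\<close>.

  Let \<open>B\<close> be a bounded measurable part of \<open>A\<close> and \<open>d\<close> the dimension of the space. The condition on
  \<open>\<gamma>\<close> says that the neighbourhood of \<open>B\<close> of radius \<open>\<delta>\<close> has volume at most \<open>b \<delta> ^ (2 - \<gamma>)\<close>
  (\<open>nbhd_volume_le\<close>). A cutoff function that drops from \<open>1\<close> to \<open>0\<close> between the distances \<open>\<delta> / 2\<close> and
  \<open>\<delta>\<close> from \<open>B\<close> has gradient of order \<open>1 / \<delta>\<close> (\<open>smooth_cutoff\<close>), and the weight is at most \<open>\<delta> ^ \<gamma>\<close>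
  there. The energy of its gradient is thus bounded by a constant, but in the critical case does not
  become small as \<open>\<delta>\<close> decreases. The remedy is logarithmic: the average of the cutoffs at \<open>N\<close>
  successive dyadic scales has gradients with disjoint supports, so its energy is of order
  \<open>N / N\<^sup>2 = 1 / N\<close> (\<open>logarithmic_cutoff\<close>). The \<open>L\<^sub>2\<close> norm is small because \<open>closure B\<close> meets \<open>\<Omega>\<close> in a
  null set.

  The general set \<open>A\<close> is the union of its parts in the annuli \<open>k \<le> |x| < k + 1\<close>. The cutoffs for
  these parts form a locally finite family and can be added and truncated to one function of small
  energy (\<open>glue_locally_finite_cutoffs\<close>). It is differentiable everywhere with locally bounded
  gradient, and for such functions the pointwise gradient is the distributional one
  (\<open>has_weak_gradient_if_GDERIV\<close>), by translation invariance of the Lebesgue integral.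

  The second assertion is the case \<open>\<gamma> = 0\<close>, as bounded coefficients satisfy the degeneracy condition
  with weight \<open>1\<close> almost everywhere.
\<close>

section \<open>Gradients and difference quotients\<close>

lemma GDERIV_sum:
  assumes "\<And>i. i \<in> I \<Longrightarrow> GDERIV (f i) x :> g i"
  shows "GDERIV (\<lambda>y. \<Sum>i\<in>I. f i y) x :> (\<Sum>i\<in>I. g i)"
  using assms unfolding gderiv_def inner_sum_right by (rule has_derivative_sum)

lemma GDERIV_imp_isCont: "GDERIV f x :> g \<Longrightarrow> isCont f x"
  unfolding gderiv_def by (rule has_derivative_continuous)

text \<open>
  Used to see that cutoff functions have zero gradient where they are locally constant or vanish.
\<close>

lemma GDERIV_eq_0_at_minimum:
  assumes "GDERIV f x :> g" "open S" "x \<in> S" "\<And>y. y \<in> S \<Longrightarrow> f x \<le> f y"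
  shows "g = 0"
proof -
  obtain e where "0 < e" "ball x e \<subseteq> S"
    using assms(2,3) openE by blast
  then have "(\<lambda>h. h \<bullet> g) = (\<lambda>h. 0)"
    using differential_zero_maxmin[of x "ball x e" f "\<lambda>h. h \<bullet> g"] assms unfolding gderiv_def
    by (auto simp: subset_iff)
  then have "g \<bullet> g = 0" by metis
  then show ?thesis by simp
qed

lemma GDERIV_quotient_tendsto:
  fixes f :: "'a::real_inner \<Rightarrow> real"
  assumes "GDERIV f x :> g"
  shows "(\<lambda>n. (f (x + inverse (real (Suc n)) *\<^sub>R e) - f x) / inverse (real (Suc n)))
    \<longlonglongrightarrow> e \<bullet> g"
proof -
  have "((\<lambda>t. f (x + t *\<^sub>R e)) has_derivative (\<lambda>t. (t *\<^sub>R e) \<bullet> g)) (at 0)"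
    by (rule has_derivative_compose[of "\<lambda>t. x + t *\<^sub>R e" "\<lambda>t. t *\<^sub>R e"])
      (use assms in \<open>auto intro!: derivative_eq_intros simp: gderiv_def\<close>)
  then have "DERIV (\<lambda>t. f (x + t *\<^sub>R e)) 0 :> e \<bullet> g"
    by (simp add: has_field_derivative_def mult_commute_abs)
  then have *: "((\<lambda>h. (f (x + h *\<^sub>R e) - f x) / h) \<longlongrightarrow> e \<bullet> g) (at 0)"
    by (simp add: DERIV_def)
  have "filterlim (\<lambda>n. inverse (real (Suc n))) (at 0) sequentially"
    by (intro filterlim_atI LIMSEQ_inverse_real_of_nat) auto
  with * show ?thesis by (rule filterlim_compose)
qed

lemma borel_measurable_vec_nth [measurable]:
  fixes f :: "'a \<Rightarrow> real ^ 'n::finite"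
  assumes "f \<in> borel_measurable M"
  shows "(\<lambda>x. f x $ i) \<in> borel_measurable M"
proof -
  have "(\<lambda>y::real ^ 'n. y $ i) \<in> borel_measurable borel"
    by (intro borel_measurable_continuous_onI continuous_intros)
  with assms show ?thesis by (rule measurable_compose)
qed

lemma borel_measurable_GDERIV:
  fixes f :: "real ^ 'n::finite \<Rightarrow> real"
  assumes "\<And>x. GDERIV f x :> G x"
  shows "G \<in> borel_measurable borel"
proof -
  have "continuous_on UNIV f"
    using assms GDERIV_imp_isCont continuous_at_imp_continuous_on by blast
  then have [measurable]: "f \<in> borel_measurable borel"
    by (rule borel_measurable_continuous_onI)
  have "(\<lambda>x. G x \<bullet> b) \<in> borel_measurable borel" for b
  proof (rule borel_measurable_LIMSEQ_metric)
    show "(\<lambda>n. (f (x + inverse (real (Suc n)) *\<^sub>R b) - f x) / inverse (real (Suc n)))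
      \<longlonglongrightarrow> G x \<bullet> b" for x
      using GDERIV_quotient_tendsto[OF assms] by (simp only: inner_commute)
  qed measurable
  then show ?thesis
    by (subst borel_measurable_euclidean_space) blast
qed

lemma integrable_indicator_mult_if_bounded:
  assumes "bounded S" "S \<in> sets borel"
  shows "integrable lborel (\<lambda>x::'a::euclidean_space. indicator S x * c :: real)"
proof -
  have "emeasure lborel S < \<infinity>" using assms(1) by (rule emeasure_bounded_finite)
  then have "integrable lborel (indicator S :: 'a \<Rightarrow> real)"
    using assms(2) by (subst integrable_indicator_iff) auto
  then show ?thesis by (rule integrable_mult_left)
qed

section \<open>Weak gradients of everywhere differentiable functions\<close>

text \<open>
  The integral of \<open>f\<close> does not change under translation, so every difference quotient of \<open>f\<close> in the
  direction of the \<open>i\<close>-th axis integrates to zero. These quotients are bounded by the Lipschitz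
  constant of \<open>f\<close> and live in a fixed ball; dominated convergence passes to the derivative.
\<close>

lemma integral_partial_derivative_eq_0:
  fixes f :: "real ^ 'n::finite \<Rightarrow> real"
  assumes f: "\<And>x. GDERIV f x :> G x" and L: "\<And>x. norm (G x) \<le> L"
    and supp: "\<And>x. R \<le> norm x \<Longrightarrow> f x = 0"
  shows "integrable lborel (\<lambda>x. G x $ i)" "(\<integral>x. G x $ i \<partial>lborel) = 0"
proof -
  define e where "e = (axis i 1 :: real ^ 'n)"
  define q where "q n x = (f (x + inverse (real (Suc n)) *\<^sub>R e) - f x) / inverse (real (Suc n))" for n x
  have norm_e: "norm e = 1" by (simp add: e_def)
  have "0 \<le> L" using L[of 0] norm_ge_zero order_trans by blast
  have cont: "continuous_on UNIV f"
    using f GDERIV_imp_isCont continuous_at_imp_continuous_on by blast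
  then have [measurable]: "f \<in> borel_measurable borel"
    by (rule borel_measurable_continuous_onI)
  have [measurable]: "G \<in> borel_measurable borel"
    using f by (rule borel_measurable_GDERIV)
  have lipschitz: "norm (f x - f y) \<le> L * norm (x - y)" for x y
  proof (rule differentiable_bound)
    show "(f has_derivative (\<lambda>h. h \<bullet> G x)) (at x within UNIV)" for x
      using f[of x] by (simp add: gderiv_def)
    show "onorm (\<lambda>h. h \<bullet> G x) \<le> L" for x
    proof (rule onorm_le)
      fix h
      have "norm (h \<bullet> G x) \<le> norm h * norm (G x)" using Cauchy_Schwarz_ineq2 by auto
      also have "\<dots> \<le> norm h * L" by (intro mult_left_mono L) auto
      finally show "norm (h \<bullet> G x) \<le> L * norm h" by (simp add: mult.commute)
    qed
  qed auto
  have fint: "integrable lborel f"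
  proof (rule Bochner_Integration.integrable_bound)
    show "integrable lborel (\<lambda>x. indicat_real (cball 0 R) x *\<^sub>R f x)"
      by (rule borel_integrable_compact)
        (use cont continuous_on_subset in \<open>auto\<close>)
    show "AE x in lborel. norm (f x) \<le> norm (indicat_real (cball 0 R) x *\<^sub>R f x)"
      using supp by (auto simp: indicator_def not_le)
  qed measurable
  have shift: "integrable lborel (\<lambda>x. f (x + c))" "(\<integral>x. f (x + c) \<partial>lborel) = (\<integral>x. f x \<partial>lborel)" for c
  proof -
    have "integrable (distr lborel borel ((+) c)) f"
      by (simp add: lborel_distr_plus fint)
    then show "integrable lborel (\<lambda>x. f (x + c))"
      by (simp add: integrable_distr_eq add.commute)
    have "(\<integral>x. f x \<partial>(distr lborel borel ((+) c))) = (\<integral>x. f (c + x) \<partial>lborel)"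
      by (rule integral_distr) auto
    then show "(\<integral>x. f (x + c) \<partial>lborel) = (\<integral>x. f x \<partial>lborel)"
      by (simp add: lborel_distr_plus add.commute)
  qed
  have qint: "(\<integral>x. q n x \<partial>lborel) = 0" for n
    unfolding q_def by (simp add: shift fint)
  have lim: "(\<lambda>n. q n x) \<longlonglongrightarrow> G x $ i" for x
    using GDERIV_quotient_tendsto[OF f, of x e]
    by (simp add: q_def e_def inner_axis')
  have bound: "norm (q n x) \<le> indicator (cball 0 (R + 1)) x * L" for n x
  proof (cases "norm x \<le> R + 1")
    case True
    define t where "t = inverse (real (Suc n))"
    have "0 < t" by (simp add: t_def)
    have "\<bar>f (x + t *\<^sub>R e) - f x\<bar> \<le> L * t"
      using lipschitz[of "x + t *\<^sub>R e" x] \<open>0 < t\<close> by (simp add: norm_e)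
    then have "norm (q n x) \<le> L"
      unfolding q_def t_def[symmetric] using \<open>0 < t\<close> by (simp add: abs_divide pos_divide_le_eq)
    with True show ?thesis by simp
  next
    case False
    have "norm x \<le> norm (x + inverse (real (Suc n)) *\<^sub>R e) + norm (inverse (real (Suc n)) *\<^sub>R e)"
      using norm_triangle_ineq4[of "x + inverse (real (Suc n)) *\<^sub>R e" "inverse (real (Suc n)) *\<^sub>R e"] by simp
    moreover have "norm (inverse (real (Suc n)) *\<^sub>R e) \<le> 1" by (simp add: norm_e field_simps)
    ultimately have "q n x = 0"
      unfolding q_def using False by (simp add: supp)
    with False \<open>0 \<le> L\<close> show ?thesis by simp
  qed
  have dom: "integrable lborel (\<lambda>x. indicator (cball 0 (R + 1)) x * L :: real)"
    by (intro integrable_indicator_mult_if_bounded) auto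
  have qm: "q n \<in> borel_measurable lborel" for n unfolding q_def by measurable
  have Gm: "(\<lambda>x. G x $ i) \<in> borel_measurable lborel" by measurable
  show "integrable lborel (\<lambda>x. G x $ i)"
    by (rule integrable_dominated_convergence[where s = q, OF Gm qm dom]) (simp_all only: lim bound AE_I2)
  have "(\<lambda>n. \<integral>x. q n x \<partial>lborel) \<longlonglongrightarrow> (\<integral>x. G x $ i \<partial>lborel)"
    by (rule integral_dominated_convergence[where s = q, OF Gm qm dom]) (simp_all only: lim bound AE_I2)
  then show "(\<integral>x. G x $ i \<partial>lborel) = 0"
    by (simp add: qint LIMSEQ_const_iff)
qed

lemma locally_integrable_if_locally_bounded:
  fixes f :: "real ^ 'n::finite \<Rightarrow> real"
  assumes [measurable]: "f \<in> borel_measurable borel"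
    and bound: "\<And>r. \<exists>M. \<forall>x. norm x \<le> r \<longrightarrow> \<bar>f x\<bar> \<le> M"
  shows "locally_integrable \<Omega> f"
  unfolding locally_integrable_def
proof (intro allI impI)
  fix K assume K: "compact K \<and> K \<subseteq> \<Omega>"
  then obtain r where r: "\<And>x. x \<in> K \<Longrightarrow> norm x \<le> r"
    using compact_imp_bounded[of K] unfolding bounded_iff by blast
  obtain M where M: "\<And>x. norm x \<le> r \<Longrightarrow> \<bar>f x\<bar> \<le> M" using bound by blast
  have [measurable]: "K \<in> sets borel" using K by (auto intro: borel_compact)
  have "set_integrable lborel K f"
    unfolding set_integrable_def
  proof (rule Bochner_Integration.integrable_bound)
    show "integrable lborel (\<lambda>x. indicator K x * M :: real)"
      using K by (intro integrable_indicator_mult_if_bounded compact_imp_bounded) simp_all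
    have "norm (indicat_real K x *\<^sub>R f x) \<le> norm (indicator K x * M :: real)" for x
      using M[of x] r[of x] by (cases "x \<in> K") auto
    then show "AE x in lborel. norm (indicat_real K x *\<^sub>R f x) \<le> norm (indicator K x * M :: real)"
      by simp
  qed measurable
  then show "set_integrable lebesgue K f"
    unfolding set_integrable_def by (subst integrable_completion) auto
qed

text \<open>
  Integration by parts is the vanishing of the integral of the \<open>i\<close>-th partial derivative of \<open>f \<eta>\<close>.
  This product has a globally bounded gradient and vanishes off the support of the test
  function \<open>\<eta>\<close>, so the previous lemma applies to it.
\<close>

lemma has_weak_gradient_if_GDERIV:
  fixes f :: "real ^ 'n::finite \<Rightarrow> real"
  assumes f: "\<And>x. GDERIV f x :> G x"
    and G_bound: "\<And>r. \<exists>M. \<forall>x. norm x \<le> r \<longrightarrow> norm (G x) \<le> M"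
  shows "has_weak_gradient \<Omega> f G"
  unfolding has_weak_gradient_def has_weak_partial_def
proof (intro allI conjI impI)
  fix i
  have cont: "continuous_on UNIV f"
    using f GDERIV_imp_isCont continuous_at_imp_continuous_on by blast
  then have [measurable]: "f \<in> borel_measurable borel"
    by (rule borel_measurable_continuous_onI)
  have [measurable]: "G \<in> borel_measurable borel"
    using f by (rule borel_measurable_GDERIV)
  have bounded_continuous: "\<exists>M. \<forall>x. norm x \<le> r \<longrightarrow> \<bar>g x\<bar> \<le> M"
    if "continuous_on UNIV g" for r and g :: "real ^ 'n \<Rightarrow> real"
  proof -
    have "compact (g ` cball 0 r)"
      using that continuous_on_subset by (intro compact_continuous_image) auto
    then have "bounded (g ` cball 0 r)" by (rule compact_imp_bounded)
    then obtain M where "\<forall>y\<in>g ` cball 0 r. norm y \<le> M" unfolding bounded_iff by blast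
    then have "\<forall>x. norm x \<le> r \<longrightarrow> \<bar>g x\<bar> \<le> M" by simp
    then show ?thesis by blast
  qed
  show "locally_integrable \<Omega> f"
    using bounded_continuous[OF cont] by (intro locally_integrable_if_locally_bounded) auto
  show "locally_integrable \<Omega> (\<lambda>x. G x $ i)"
  proof (rule locally_integrable_if_locally_bounded)
    show "\<exists>M. \<forall>x. norm x \<le> r \<longrightarrow> \<bar>G x $ i\<bar> \<le> M" for r
      using G_bound[of r] component_le_norm_cart order_trans by blast
    show "(\<lambda>x. G x $ i) \<in> borel_measurable borel" by measurable
  qed
  fix \<eta> assume \<eta>: "test_function \<Omega> \<eta>"
  define D where "D x = (\<chi> j. partial_deriv j \<eta> x)" for x
  have "Ck (Suc 0) \<eta>" using \<eta> unfolding test_function_def by blast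
  then have diff: "\<eta> differentiable (at x)" and contD: "continuous_on UNIV (partial_deriv j \<eta>)" for x j
    by auto
  have D: "GDERIV \<eta> x :> D x" for x
  proof -
    have der: "(\<eta> has_derivative frechet_derivative \<eta> (at x)) (at x)"
      using diff frechet_derivative_works by blast
    then have lin: "linear (frechet_derivative \<eta> (at x))"
      by (rule has_derivative_linear)
    have "frechet_derivative \<eta> (at x) h = h \<bullet> D x" for h
    proof -
      have "h = (\<Sum>j\<in>UNIV. h $ j *\<^sub>R axis j 1)"
        using basis_expansion[of h] by (simp add: scalar_mult_eq_scaleR)
      then have "frechet_derivative \<eta> (at x) h = frechet_derivative \<eta> (at x) (\<Sum>j\<in>UNIV. h $ j *\<^sub>R axis j 1)"
        by simp
      also have "\<dots> = (\<Sum>j\<in>UNIV. h $ j * frechet_derivative \<eta> (at x) (axis j 1))"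
        by (simp add: linear_sum[OF lin] linear_scale[OF lin])
      finally show ?thesis by (simp add: D_def inner_vec_def partial_deriv_def)
    qed
    then have "frechet_derivative \<eta> (at x) = (\<lambda>h. h \<bullet> D x)" by auto
    then show ?thesis using der unfolding gderiv_def by simp
  qed
  have cont\<eta>: "continuous_on UNIV \<eta>"
    using D GDERIV_imp_isCont continuous_at_imp_continuous_on by blast
  then have [measurable]: "\<eta> \<in> borel_measurable borel"
    by (rule borel_measurable_continuous_onI)
  have [measurable]: "D \<in> borel_measurable borel"
    using D by (rule borel_measurable_GDERIV)
  have contD': "continuous_on UNIV (\<lambda>x. norm (D x))"
    unfolding D_def using contD by (intro continuous_intros) auto
  define S where "S = closure {x. \<eta> x \<noteq> 0}"
  have S: "compact S" "S \<subseteq> \<Omega>" using \<eta> unfolding test_function_def S_def by auto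
  have \<eta>0: "\<eta> x = 0" if "x \<notin> S" for x
    using that closure_subset[of "{x. \<eta> x \<noteq> 0}"] unfolding S_def by auto
  have D0: "D x = 0" if "x \<notin> S" for x
  proof -
    have eq: "\<eta> x = \<eta> y" if "y \<in> - S" for y
      using \<eta>0 that \<open>x \<notin> S\<close> by auto
    have "open (- S)" unfolding S_def by auto
    then show ?thesis
      by (rule GDERIV_eq_0_at_minimum[OF D]) (use eq that in auto)
  qed
  obtain R where R: "\<And>x. x \<in> S \<Longrightarrow> norm x \<le> R"
    using compact_imp_bounded[OF S(1)] unfolding bounded_iff by blast
  obtain Mf where Mf: "\<And>x. norm x \<le> R \<Longrightarrow> \<bar>f x\<bar> \<le> Mf" using bounded_continuous[OF cont] by blast
  obtain M\<eta> where M\<eta>: "\<And>x. norm x \<le> R \<Longrightarrow> \<bar>\<eta> x\<bar> \<le> M\<eta>" using bounded_continuous[OF cont\<eta>] by blast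
  obtain MD where MD: "\<And>x. norm x \<le> R \<Longrightarrow> norm (D x) \<le> MD" using bounded_continuous[OF contD'] by auto
  obtain MG where MG: "\<And>x. norm x \<le> R \<Longrightarrow> norm (G x) \<le> MG" using G_bound by blast
  define P where "P x = f x *\<^sub>R D x + \<eta> x *\<^sub>R G x" for x
  have P: "GDERIV (\<lambda>x. f x * \<eta> x) x :> P x" for x
    unfolding P_def by (rule GDERIV_mult[OF f D])
  have P_bound: "norm (P x) \<le> \<bar>Mf * MD + M\<eta> * MG\<bar>" for x
  proof (cases "x \<in> S")
    case True
    have "norm (P x) \<le> \<bar>f x\<bar> * norm (D x) + \<bar>\<eta> x\<bar> * norm (G x)"
      unfolding P_def by (rule norm_triangle_le) simp
    also have "\<dots> \<le> Mf * MD + M\<eta> * MG"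
      using Mf[OF R[OF True]] M\<eta>[OF R[OF True]] MD[OF R[OF True]] MG[OF R[OF True]]
      by (intro add_mono mult_mono) auto
    finally show ?thesis by simp
  qed (simp add: P_def \<eta>0 D0)
  have supp: "f x * \<eta> x = 0" if "R + 1 \<le> norm x" for x
    using R[of x] \<eta>0[of x] that by force
  note P_int = integral_partial_derivative_eq_0[where R = "R + 1" and i = i, OF P P_bound supp]
  have f_int: "integrable lborel (\<lambda>x. f x * D x $ i)"
  proof (rule Bochner_Integration.integrable_bound)
    show "integrable lborel (\<lambda>x. indicator S x * (Mf * MD) :: real)"
      using S by (intro integrable_indicator_mult_if_bounded)
        (simp_all add: borel_compact compact_imp_bounded)
    have "\<bar>f x * D x $ i\<bar> \<le> \<bar>Mf * MD\<bar>" if "x \<in> S" for x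
    proof -
      have "\<bar>f x * D x $ i\<bar> \<le> Mf * MD" unfolding abs_mult
        using Mf[OF R[OF that]] MD[OF R[OF that]] component_le_norm_cart[of "D x" i]
        by (intro mult_mono) auto
      then show ?thesis by simp
    qed
    then show "AE x in lborel. norm (f x * D x $ i) \<le> norm (indicator S x * (Mf * MD) :: real)"
      using D0 by (auto simp: indicator_def)
  qed measurable
  have G_int: "integrable lborel (\<lambda>x. G x $ i * \<eta> x)"
    using Bochner_Integration.integrable_diff[OF P_int(1) f_int] by (simp add: P_def mult.commute)
  have "(LINT x:\<Omega>|lebesgue. f x * partial_deriv i \<eta> x) = (\<integral>x. f x * D x $ i \<partial>lebesgue)"
    unfolding set_lebesgue_integral_def using D0 S(2)
    by (intro Bochner_Integration.integral_cong) (auto simp: indicator_def D_def vec_eq_iff subset_iff)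
  also have "\<dots> = (\<integral>x. f x * D x $ i \<partial>lborel)"
    by (rule integral_completion) measurable
  also have "\<dots> = - (\<integral>x. G x $ i * \<eta> x \<partial>lborel)"
    using P_int(2) f_int G_int by (simp add: P_def mult.commute)
  also have "(\<integral>x. G x $ i * \<eta> x \<partial>lborel) = (\<integral>x. G x $ i * \<eta> x \<partial>lebesgue)"
    by (rule integral_completion[symmetric]) measurable
  also have "\<dots> = (LINT x:\<Omega>|lebesgue. G x $ i * \<eta> x)"
    unfolding set_lebesgue_integral_def using \<eta>0 S(2)
    by (intro Bochner_Integration.integral_cong) (auto simp: indicator_def subset_iff)
  finally show "(LINT x:\<Omega>|lebesgue. f x * partial_deriv i \<eta> x) = - (LINT x:\<Omega>|lebesgue. G x $ i * \<eta> x)" .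
qed

section \<open>A differentiable truncation\<close>

text \<open>
  The positive part is squared to make it differentiable everywhere. The function
  \<open>1 - pos_square (1 - t)\<close> of \<open>t \<ge> 0\<close>, with value \<open>0\<close> at \<open>0\<close>, values in \<open>[0, 1]\<close>, value \<open>1\<close> from \<open>1\<close>
  on and derivative at most \<open>2\<close>, serves below as a differentiable truncation at height \<open>1\<close>.
\<close>

definition pos_square :: "real \<Rightarrow> real" where
  "pos_square t = (max 0 t)\<^sup>2"

lemma pos_square_simps:
  "0 \<le> pos_square t" "t \<le> 0 \<Longrightarrow> pos_square t = 0" "t \<le> 1 \<Longrightarrow> pos_square t \<le> 1"
  "pos_square 1 = 1"
  by (auto simp: pos_square_def max_def power_le_one)

lemma DERIV_pos_square: "DERIV pos_square t :> 2 * max 0 t"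
proof (cases t "0::real" rule: linorder_cases)
  case less
  have "DERIV (\<lambda>_. 0) t :> (0::real)" by simp
  then have "DERIV pos_square t :> 0"
    by (rule has_field_derivative_transform_within_open[where S = "{..<0}"])
      (use less in \<open>auto simp: pos_square_def\<close>)
  then show ?thesis using less by simp
next
  case greater
  have "DERIV (\<lambda>t. t\<^sup>2) t :> 2 * t" by (auto intro!: derivative_eq_intros)
  then have "DERIV pos_square t :> 2 * t"
    by (rule has_field_derivative_transform_within_open[where S = "{0<..}"])
      (use greater in \<open>auto simp: pos_square_def\<close>)
  then show ?thesis using greater by simp
next
  case equal
  have "(\<lambda>h. (pos_square (0 + h) - pos_square 0) / h) = (\<lambda>h. max 0 h)"
    by (auto simp: fun_eq_iff pos_square_def max_def power2_eq_square)
  moreover have "((\<lambda>h. max 0 h) \<longlongrightarrow> max 0 0) (at (0::real))" by (intro tendsto_intros)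
  ultimately have "((\<lambda>h. (pos_square (0 + h) - pos_square 0) / h) \<longlongrightarrow> 0) (at 0)" by simp
  then show ?thesis using equal by (simp add: DERIV_def)
qed

section \<open>Separated nets\<close>

text \<open>
  The balls of radius \<open>s\<close> around the points of \<open>Z\<close> are disjoint and contained in one ball of
  radius \<open>R + s\<close>; compare volumes.
\<close>

lemma card_separated_le:
  fixes x :: "'a::euclidean_space"
  assumes "finite Z" "Z \<subseteq> cball x R" "0 < s" "0 \<le> R"
    and sep: "\<And>y z. y \<in> Z \<Longrightarrow> z \<in> Z \<Longrightarrow> y \<noteq> z \<Longrightarrow> 2 * s \<le> dist y z"
  shows "real (card Z) * s ^ DIM('a) \<le> (R + s) ^ DIM('a)"
proof -
  have "disjoint_family_on (\<lambda>z. ball z s) Z"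
  proof (unfold disjoint_family_on_def, intro ballI impI)
    fix y z assume "y \<in> Z" "z \<in> Z" "y \<noteq> z"
    then have "2 * s \<le> dist y z" by (rule sep)
    then show "ball y s \<inter> ball z s = {}" by (intro disjoint_ballI) simp
  qed
  then have "(\<Sum>z\<in>Z. emeasure lborel (ball z s)) = emeasure lborel (\<Union>z\<in>Z. ball z s)"
    by (intro sum_emeasure) (use assms in auto)
  also have "\<dots> \<le> emeasure lborel (ball x (R + s))"
  proof (rule emeasure_mono)
    show "(\<Union>z\<in>Z. ball z s) \<subseteq> ball x (R + s)"
    proof
      fix u assume "u \<in> (\<Union>z\<in>Z. ball z s)"
      then obtain z where "z \<in> Z" "dist z u < s" by auto
      then have "dist x z \<le> R" using assms(2) by auto
      with \<open>dist z u < s\<close> show "u \<in> ball x (R + s)" using dist_triangle[of x u z] by simp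
    qed
  qed simp
  finally have "ennreal (real (card Z) * (unit_ball_vol DIM('a) * s ^ DIM('a)))
    \<le> ennreal (unit_ball_vol DIM('a) * (R + s) ^ DIM('a))"
    using assms by (simp add: emeasure_ball ennreal_mult ennreal_of_nat_eq_real_of_nat)
  then have "real (card Z) * (unit_ball_vol DIM('a) * s ^ DIM('a))
    \<le> unit_ball_vol DIM('a) * (R + s) ^ DIM('a)"
    using assms by (subst (asm) ennreal_le_iff) auto
  then have "unit_ball_vol DIM('a) * (real (card Z) * s ^ DIM('a))
    \<le> unit_ball_vol DIM('a) * (R + s) ^ DIM('a)" by (simp only: mult.left_commute)
  then show ?thesis by (subst (asm) mult_le_cancel_left_pos) auto
qed

text \<open>
  The packing bound limits the size of separated subsets of \<open>B\<close>, and one of maximal size is a net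
  since no further point can be added to it.
\<close>

lemma ex_separated_net:
  fixes B :: "'a::euclidean_space set"
  assumes "bounded B" "0 < s"
  obtains Z where "finite Z" "Z \<subseteq> B"
    "\<And>y z. y \<in> Z \<Longrightarrow> z \<in> Z \<Longrightarrow> y \<noteq> z \<Longrightarrow> 2 * s \<le> dist y z"
    "\<And>y. y \<in> B \<Longrightarrow> \<exists>z\<in>Z. dist y z < 2 * s"
proof -
  define Sep where "Sep Z \<longleftrightarrow> finite Z \<and> Z \<subseteq> B \<and>
    (\<forall>y\<in>Z. \<forall>z\<in>Z. y \<noteq> z \<longrightarrow> 2 * s \<le> dist y z)" for Z
  obtain R where R: "0 < R" "\<forall>y\<in>B. norm y \<le> R"
    using assms(1) unfolding bounded_pos by blast
  obtain n where n: "((R + s) / s) ^ DIM('a) < real n"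
    using reals_Archimedean2 by blast
  have "card Z < n" if "Sep Z" for Z
  proof -
    have "real (card Z) * s ^ DIM('a) \<le> (R + s) ^ DIM('a)"
      by (rule card_separated_le[where x = 0]) (use that R assms in \<open>auto simp: Sep_def subset_iff\<close>)
    then have "real (card Z) \<le> ((R + s) / s) ^ DIM('a)"
      using assms by (simp add: power_divide pos_le_divide_eq)
    with n show ?thesis by linarith
  qed
  moreover have "Sep {}" by (simp add: Sep_def)
  ultimately obtain Z where Z: "Sep Z" "\<And>Y. Sep Y \<Longrightarrow> card Y \<le> card Z"
    using ex_has_greatest_nat[of Sep "{}" card n] by (metis less_imp_le)
  have "\<exists>z\<in>Z. dist y z < 2 * s" if "y \<in> B" for y
  proof (rule ccontr)
    assume "\<not> (\<exists>z\<in>Z. dist y z < 2 * s)"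
    then have far: "\<And>z. z \<in> Z \<Longrightarrow> 2 * s \<le> dist y z" by force
    then have "y \<notin> Z" using assms by force
    have "Sep (insert y Z)"
      using Z(1) far that unfolding Sep_def by (auto simp: dist_commute)
    then have "card (insert y Z) \<le> card Z" by (rule Z)
    with \<open>y \<notin> Z\<close> Z(1) show False by (simp add: Sep_def)
  qed
  with Z(1) show ?thesis using that unfolding Sep_def by blast
qed

section \<open>Cutoff functions at a single scale\<close>

lemma open_nbhd: "open (nbhd B \<delta>)"
  unfolding nbhd_def by (cases "B = {}") (auto intro!: open_Collect_less continuous_intros)

lemma nbhd_iff: "x \<in> nbhd B \<delta> \<longleftrightarrow> (\<exists>y\<in>B. dist x y < \<delta>)"
proof
  assume "x \<in> nbhd B \<delta>"
  then have "B \<noteq> {}" "infdist x B < \<delta>" by (auto simp: nbhd_def)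
  then show "\<exists>y\<in>B. dist x y < \<delta>"
    using cInf_lessD[of "dist x ` B" \<delta>] infdist_notempty[of B x] by auto
next
  assume "\<exists>y\<in>B. dist x y < \<delta>"
  then obtain y where "y \<in> B" "dist x y < \<delta>" by blast
  then show "x \<in> nbhd B \<delta>" using infdist_le[of y B x] by (auto simp: nbhd_def)
qed

lemma bounded_nbhd:
  assumes "bounded B" shows "bounded (nbhd B \<delta>)"
proof -
  obtain R where R: "\<And>y. y \<in> B \<Longrightarrow> norm y \<le> R" using assms unfolding bounded_iff by blast
  have "norm x \<le> R + \<delta>" if x: "x \<in> nbhd B \<delta>" for x
  proof -
    obtain y where "y \<in> B" "dist x y < \<delta>" using x unfolding nbhd_iff by blast
    then show ?thesis using R[of y] norm_triangle_sub[of x y] by (simp add: dist_norm)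
  qed
  then show ?thesis unfolding bounded_iff by blast
qed

lemma nbhd_mono: "\<delta> \<le> \<delta>' \<Longrightarrow> nbhd B \<delta> \<subseteq> nbhd B \<delta>'"
  by (auto simp: nbhd_def)

lemma subset_nbhd: "0 < \<delta> \<Longrightarrow> B \<subseteq> nbhd B \<delta>"
  by (auto simp: nbhd_def)

lemma emeasure_nbhd:
  assumes "bounded B"
  shows "emeasure lebesgue (nbhd B \<delta>) = ennreal (measure lebesgue (nbhd B \<delta>))"
proof (rule emeasure_eq_ennreal_measure)
  have "emeasure lebesgue (nbhd B \<delta>) = emeasure lborel (nbhd B \<delta>)"
    by (subst emeasure_completion) (auto simp: open_nbhd)
  then show "emeasure lebesgue (nbhd B \<delta>) \<noteq> top"
    using emeasure_bounded_finite[OF bounded_nbhd[OF assms], of \<delta>] by (simp add: less_top)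
qed

text \<open>
  Take a net \<open>Z\<close> of \<open>B\<close> at scale \<open>\<delta> / 4\<close>, add the bumps \<open>pos_square (1 - |x - z|\<^sup>2 / \<delta>\<^sup>2)\<close> over
  \<open>z \<in> Z\<close>, and truncate. Close to \<open>B\<close> a single bump is already large, and near a given point only
  \<open>9 ^ d\<close> bumps can overlap by the packing bound, so the gradient is of order \<open>1 / \<delta>\<close> with a
  constant that depends on the dimension \<open>d\<close> alone.
\<close>

lemma smooth_cutoff:
  fixes B :: "(real ^ 'n::finite) set"
  assumes "bounded B" "0 < \<delta>"
  obtains h g where "\<And>x. GDERIV h x :> g x" "\<And>x. 0 \<le> h x" "\<And>x. h x \<le> 1"
    "\<And>x. x \<in> nbhd B (\<delta> / 2) \<Longrightarrow> h x = 1" "\<And>x. x \<notin> nbhd B \<delta> \<Longrightarrow> h x = 0"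
    "\<And>x. x \<in> nbhd B (\<delta> / 2) \<Longrightarrow> g x = 0" "\<And>x. x \<notin> nbhd B \<delta> \<Longrightarrow> g x = 0"
    "\<And>x. norm (g x) \<le> 48 * 9 ^ CARD('n) / \<delta>"
proof -
  obtain Z where Z: "finite Z" "Z \<subseteq> B"
    "\<And>y z. y \<in> Z \<Longrightarrow> z \<in> Z \<Longrightarrow> y \<noteq> z \<Longrightarrow> 2 * (\<delta> / 8) \<le> dist y z"
    "\<And>y. y \<in> B \<Longrightarrow> \<exists>z\<in>Z. dist y z < 2 * (\<delta> / 8)"
    by (rule ex_separated_net[OF assms(1), of "\<delta> / 8"]) (simp add: assms(2), rule that)
  define v where "v z x = 1 - (1 / \<delta>\<^sup>2) * ((x - z) \<bullet> (x - z))" for z x :: "real ^ 'n"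
  define H where "H x = (\<Sum>z\<in>Z. pos_square (v z x))" for x
  define t where "t z x = (2 * max 0 (v z x)) *\<^sub>R (- (2 / \<delta>\<^sup>2) *\<^sub>R (x - z))" for z x
  define h where "h x = 1 - pos_square (1 - 6 * H x)" for x
  define g where "g x = (12 * max 0 (1 - 6 * H x)) *\<^sub>R (\<Sum>z\<in>Z. t z x)" for x
  have "GDERIV (v z) x :> - (2 / \<delta>\<^sup>2) *\<^sub>R (x - z)" for z x
    unfolding gderiv_def v_def
    by (rule derivative_eq_intros refl)+
      (simp add: fun_eq_iff inner_commute inner_diff_right divide_simps assms(2) algebra_simps)
  then have "GDERIV (\<lambda>x. pos_square (v z x)) x :> t z x" for z x
    unfolding t_def by (rule GDERIV_DERIV_compose[OF _ DERIV_pos_square])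
  then have "GDERIV H x :> (\<Sum>z\<in>Z. t z x)" for x
    unfolding H_def by (rule GDERIV_sum)
  then have "GDERIV (\<lambda>x. 1 - pos_square (1 - 6 * H x)) x
      :> (- (2 * max 0 (1 - 6 * H x) * - 6)) *\<^sub>R (\<Sum>z\<in>Z. t z x)" for x
    by (rule GDERIV_DERIV_compose)
      (auto intro!: derivative_eq_intros DERIV_pos_square[THEN DERIV_chain2])
  then have deriv: "GDERIV h x :> g x" for x
    unfolding h_def g_def by simp
  have H_nonneg: "0 \<le> H x" for x
    unfolding H_def by (intro sum_nonneg pos_square_simps)
  have h_range: "0 \<le> h x" "h x \<le> 1" for x
    using H_nonneg[of x] pos_square_simps(1,3)[of "1 - 6 * H x"] by (auto simp: h_def)
  have v_dist: "v z x = 1 - (dist x z / \<delta>)\<^sup>2" for z x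
    by (simp add: v_def dist_norm power2_norm_eq_inner power_divide)
  have v_far: "v z x \<le> 0" if "\<delta> \<le> dist x z" for z x
  proof -
    have "1 \<le> dist x z / \<delta>" using that assms(2) by simp
    then show ?thesis unfolding v_dist using one_le_power by fastforce
  qed
  \<comment> \<open>At distance at most \<open>3 \<delta> / 4\<close> from \<open>z\<close> the bump is at least \<open>(7 / 16)\<^sup>2 > 1 / 6\<close>; hence the factor 6.\<close>
  have h_one: "h x = 1" if x: "x \<in> nbhd B (\<delta> / 2)" for x
  proof -
    obtain y where "y \<in> B" "dist x y < \<delta> / 2" using x unfolding nbhd_iff by blast
    moreover obtain z where z: "z \<in> Z" "dist y z < 2 * (\<delta> / 8)" using Z(4) \<open>y \<in> B\<close> by blast
    ultimately have "dist x z \<le> 3 / 4 * \<delta>" using dist_triangle[of x z y] by simp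
    then have "dist x z / \<delta> \<le> 3 / 4" using assms(2) by (simp add: pos_divide_le_eq)
    then have "(dist x z / \<delta>)\<^sup>2 \<le> (3 / 4)\<^sup>2" using assms(2) by (intro power_mono) auto
    then have "7 / 16 \<le> v z x" unfolding v_dist by (simp add: power2_eq_square)
    then have "(7 / 16)\<^sup>2 \<le> pos_square (v z x)"
      unfolding pos_square_def by (intro power_mono) auto
    also have "\<dots> \<le> H x"
      unfolding H_def using Z(1) z(1) by (intro member_le_sum pos_square_simps) auto
    finally show ?thesis by (simp add: h_def pos_square_simps power2_eq_square)
  qed
  have h_zero: "h x = 0" if "x \<notin> nbhd B \<delta>" for x
  proof -
    have "H x = 0"
      unfolding H_def using that Z(2) unfolding nbhd_iff
      by (intro sum.neutral ballI pos_square_simps(2) v_far) (auto simp: not_less)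
    then show ?thesis by (simp add: h_def pos_square_simps)
  qed
  have g_zero_near: "g x = 0" if "x \<in> nbhd B (\<delta> / 2)" for x
    by (rule GDERIV_eq_0_at_minimum[OF deriv open_nbhd that]) (simp add: that h_one)
  have g_zero_far: "g x = 0" if "x \<notin> nbhd B \<delta>" for x
    by (rule GDERIV_eq_0_at_minimum[OF deriv open_UNIV]) (simp_all add: that h_zero h_range)
  have "norm (g x) \<le> 48 * 9 ^ CARD('n) / \<delta>" for x
  proof -
    define Y where "Y = {z \<in> Z. dist x z < \<delta>}"
    have "real (card Y) * (\<delta> / 8) ^ DIM(real ^ 'n) \<le> (\<delta> + \<delta> / 8) ^ DIM(real ^ 'n)"
      by (rule card_separated_le[where x = x]) (use Z assms in \<open>auto simp: Y_def\<close>)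
    also have "(\<delta> + \<delta> / 8) ^ DIM(real ^ 'n) = 9 ^ CARD('n) * (\<delta> / 8) ^ DIM(real ^ 'n)"
      by (simp flip: power_mult_distrib)
    finally have card_Y: "real (card Y) \<le> 9 ^ CARD('n)" using assms(2) by simp
    have t_far: "t z x = 0" if "z \<in> Z - Y" for z
      using that v_far[of x z] by (auto simp: t_def Y_def)
    have t_near: "norm (t z x) \<le> 4 / \<delta>" if "z \<in> Y" for z
    proof -
      have "norm (t z x) = 2 * max 0 (v z x) * (2 / \<delta>\<^sup>2 * dist x z)"
        by (simp add: t_def dist_norm)
      also have "\<dots> \<le> 2 * 1 * (2 / \<delta>\<^sup>2 * \<delta>)"
        using that by (intro mult_mono) (auto simp: Y_def v_dist)
      finally show ?thesis using assms(2) by (simp add: power2_eq_square)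
    qed
    have "norm (\<Sum>z\<in>Z. t z x) = norm (\<Sum>z\<in>Y. t z x)"
      using t_far Z(1) by (subst sum.mono_neutral_right[of Z Y]) (auto simp: Y_def)
    also have "\<dots> \<le> real (card Y) * (4 / \<delta>)"
      using sum_norm_bound[of Y "\<lambda>z. t z x" "4 / \<delta>"] t_near by simp
    also have "\<dots> \<le> 9 ^ CARD('n) * (4 / \<delta>)"
      using card_Y assms(2) by (intro mult_right_mono) auto
    finally have "norm (\<Sum>z\<in>Z. t z x) \<le> 9 ^ CARD('n) * (4 / \<delta>)" .
    moreover have "\<bar>12 * max 0 (1 - 6 * H x)\<bar> \<le> 12" using H_nonneg[of x] by auto
    ultimately have "norm (g x) \<le> 12 * (9 ^ CARD('n) * (4 / \<delta>))"
      unfolding g_def norm_scaleR using assms(2) by (intro mult_mono) auto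
    then show ?thesis by simp
  qed
  with deriv h_range h_one h_zero g_zero_near g_zero_far show ?thesis using that by blast
qed

section \<open>Logarithmic cutoff functions\<close>

lemma norm_sum_power2_if_at_most_one_nonzero:
  fixes v :: "'i \<Rightarrow> 'a::real_normed_vector"
  assumes "finite I" "\<And>i j. i \<in> I \<Longrightarrow> j \<in> I \<Longrightarrow> i \<noteq> j \<Longrightarrow> v i = 0 \<or> v j = 0"
  shows "(norm (\<Sum>i\<in>I. v i))\<^sup>2 = (\<Sum>i\<in>I. (norm (v i))\<^sup>2)"
  using assms
proof (induction I rule: finite_induct)
  case (insert a I)
  show ?case
  proof (cases "v a = 0")
    case False
    then have "\<forall>i\<in>I. v i = 0" using insert by (metis insertCI)
    then show ?thesis using insert by simp
  qed (use insert in auto)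
qed simp

lemma borel_measurable_completion:
  "f \<in> borel_measurable borel \<Longrightarrow> f \<in> borel_measurable lebesgue"
  by (rule measurable_completion) simp

lemma emeasure_nbhd_Int_tendsto_0:
  assumes "open \<Omega>" "bounded B" and null: "emeasure lebesgue (\<Omega> \<inter> closure B) = 0"
  shows "(\<lambda>n. emeasure lebesgue (\<Omega> \<inter> nbhd B (1 / Suc n))) \<longlonglongrightarrow> 0"
proof -
  let ?S = "\<lambda>n. \<Omega> \<inter> nbhd B (1 / Suc n)"
  have "(\<lambda>n. emeasure lebesgue (?S n)) \<longlonglongrightarrow> emeasure lebesgue (\<Inter>n. ?S n)"
  proof (rule Lim_emeasure_decseq)
    show "range ?S \<subseteq> sets lebesgue"
      using assms(1) by (auto intro!: sets.Int simp: open_nbhd)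
    show "decseq ?S"
    proof (rule decseq_SucI)
      show "?S (Suc n) \<subseteq> ?S n" for n
        using nbhd_mono[of "1 / Suc (Suc n)" "1 / Suc n" B] by (auto simp: field_simps)
    qed
    show "emeasure lebesgue (?S n) \<noteq> \<infinity>" for n
    proof -
      have "emeasure lebesgue (?S n) \<le> emeasure lebesgue (nbhd B (1 / Suc n))"
        by (rule emeasure_mono) (auto simp: open_nbhd)
      also have "\<dots> < \<infinity>" by (simp add: emeasure_nbhd[OF assms(2)])
      finally show ?thesis by simp
    qed
  qed
  moreover have "(\<Inter>n. ?S n) \<subseteq> \<Omega> \<inter> closure B"
  proof
    fix x assume x: "x \<in> (\<Inter>n. ?S n)"
    then have "B \<noteq> {}" by (auto simp: nbhd_def)
    have "infdist x B \<le> 0"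
    proof (rule LIMSEQ_le_const[OF LIMSEQ_inverse_real_of_nat])
      show "\<exists>N. \<forall>n\<ge>N. infdist x B \<le> inverse (real (Suc n))"
        using x by (auto simp: nbhd_def inverse_eq_divide intro: less_imp_le)
    qed
    then have "infdist x B = 0" using infdist_nonneg[of x B] by simp
    with x \<open>B \<noteq> {}\<close> show "x \<in> \<Omega> \<inter> closure B" by (simp add: in_closure_iff_infdist_zero)
  qed
  then have "emeasure lebesgue (\<Inter>n. ?S n) \<le> emeasure lebesgue (\<Omega> \<inter> closure B)"
    using assms(1) by (intro emeasure_mono) auto
  ultimately show ?thesis using null by simp
qed

text \<open>
  The average \<open>f\<close> of the cutoffs \<open>h m\<close> at the \<open>N\<close> dyadic scales \<open>\<delta> m = \<rho> / 2 ^ m\<close> imitates the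
  function \<open>ln (\<rho> / dist x B)\<close>, truncated and normalised. The gradient of \<open>h m\<close> lives in the shell
  of points at distance between \<open>\<delta> m / 2\<close> and \<open>\<delta> m\<close> from \<open>B\<close>. There
  \<open>w |\<nabla>(h m)|\<^sup>2 \<le> K\<^sup>2 (\<delta> m) ^ (\<gamma> - 2)\<close>, while the volume is at most \<open>b (\<delta> m) ^ (2 - \<gamma>)\<close>, so every
  scale costs at most \<open>K\<^sup>2 b\<close>. The shells being disjoint, the energy of the average is at most
  \<open>N * K\<^sup>2 b / N\<^sup>2\<close>, which tends to zero as \<open>N\<close> grows. The summand \<open>f\<^sup>2\<close> is made small by the choice
  of \<open>\<rho>\<close>, because the part of \<open>\<Omega>\<close> within distance \<open>\<rho>\<close> of \<open>B\<close> shrinks to a null set.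
\<close>

lemma logarithmic_cutoff:
  fixes \<Omega> B :: "(real ^ 'n::finite) set" and w :: "real ^ 'n \<Rightarrow> real"
  assumes "open \<Omega>" "bounded B" "0 < b" "0 < \<epsilon>"
    and weight: "\<And>x \<delta>. 0 < \<delta> \<Longrightarrow> \<delta> \<le> 1 \<Longrightarrow> x \<in> \<Omega> \<inter> nbhd B \<delta> \<Longrightarrow> w x \<le> \<delta> powr \<gamma>"
    and volume: "\<And>\<delta>. 0 < \<delta> \<Longrightarrow> \<delta> \<le> 1 \<Longrightarrow> measure lebesgue (nbhd B \<delta>) \<le> b * \<delta> powr (2 - \<gamma>)"
    and null: "emeasure lebesgue (\<Omega> \<inter> closure B) = 0"
  obtains f G r where "0 < r" "\<And>x. GDERIV f x :> G x" "\<And>x. 0 \<le> f x"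
    "\<And>x. x \<in> nbhd B r \<Longrightarrow> f x = 1"
    "\<And>x. x \<notin> nbhd B 1 \<Longrightarrow> f x = 0" "\<And>x. x \<notin> nbhd B 1 \<Longrightarrow> G x = 0"
    "\<exists>M. \<forall>x. norm (G x) \<le> M"
    "(\<integral>\<^sup>+x\<in>\<Omega>. ennreal (w x * (norm (G x))\<^sup>2 + (f x)\<^sup>2) \<partial>lebesgue) \<le> ennreal \<epsilon>"
proof -
  define K where "K = (48 * 9 ^ CARD('n) :: real)"
  have "0 < K" by (simp add: K_def)
  have "\<forall>\<^sub>F n in sequentially. emeasure lebesgue (\<Omega> \<inter> nbhd B (1 / Suc n)) < ennreal (\<epsilon> / 2)"
    using order_tendstoD(2)[OF emeasure_nbhd_Int_tendsto_0[OF assms(1,2) null]] assms(4) by simp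
  then obtain n where n: "emeasure lebesgue (\<Omega> \<inter> nbhd B (1 / Suc n)) < ennreal (\<epsilon> / 2)"
    using eventually_sequentially by auto
  define \<rho> where "\<rho> = 1 / real (Suc n)"
  have \<rho>: "0 < \<rho>" "\<rho> \<le> 1" by (auto simp: \<rho>_def)
  define \<delta> where "\<delta> m = \<rho> / 2 ^ m" for m :: nat
  have \<delta>: "0 < \<delta> m" "\<delta> m \<le> \<rho>" "\<delta> m \<le> 1" "\<delta> (Suc m) = \<delta> m / 2" for m
  proof -
    show "0 < \<delta> m" "\<delta> (Suc m) = \<delta> m / 2" using \<rho> by (auto simp: \<delta>_def)
    show "\<delta> m \<le> \<rho>" unfolding \<delta>_def using \<rho> by (simp add: divide_le_eq)
    then show "\<delta> m \<le> 1" using \<rho> by simp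
  qed
  have \<delta>_antimono: "\<delta> l \<le> \<delta> m" if "m \<le> l" for m l
    unfolding \<delta>_def using that \<rho> by (intro divide_left_mono power_increasing) auto
  have "\<exists>h g. (\<forall>x. GDERIV h x :> g x) \<and> (\<forall>x. 0 \<le> h x \<and> h x \<le> 1)
      \<and> (\<forall>x. (x \<in> nbhd B (\<delta> (Suc m)) \<longrightarrow> h x = 1 \<and> g x = 0)
        \<and> (x \<notin> nbhd B (\<delta> m) \<longrightarrow> h x = 0 \<and> g x = 0) \<and> norm (g x) \<le> K / \<delta> m)" for m
    by (rule smooth_cutoff[OF assms(2) \<delta>(1)[of m]]) (unfold \<delta>(4) K_def, blast)
  then obtain h g where deriv: "\<And>m x. GDERIV (h m) x :> g m x"
    and h_range: "\<And>m x. 0 \<le> h m x" "\<And>m x. h m x \<le> 1"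
    and near: "\<And>m x. x \<in> nbhd B (\<delta> (Suc m)) \<Longrightarrow> h m x = 1 \<and> g m x = 0"
    and far: "\<And>m x. x \<notin> nbhd B (\<delta> m) \<Longrightarrow> h m x = 0 \<and> g m x = 0"
    and g_le: "\<And>m x. norm (g m x) \<le> K / \<delta> m"
    by metis
  \<comment> \<open>The energy of the gradients will be at most \<open>K\<^sup>2 b / N\<close>.\<close>
  obtain N :: nat where N: "2 * K\<^sup>2 * b / \<epsilon> < real N" using reals_Archimedean2 by blast
  have "0 \<le> 2 * K\<^sup>2 * b / \<epsilon>" using assms by simp
  then have "0 < real N" using N by linarith
  have N': "K\<^sup>2 * b / real N \<le> \<epsilon> / 2"
    using N \<open>0 < real N\<close> assms(4) by (simp add: field_simps)
  define f where "f x = (1 / real N) * (\<Sum>m<N. h m x)" for x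
  define G where "G x = (1 / real N) *\<^sub>R (\<Sum>m<N. g m x)" for x
  have f_deriv: "GDERIV f x :> G x" for x
    unfolding f_def G_def
    by (rule GDERIV_DERIV_compose[OF GDERIV_sum[OF deriv] DERIV_cmult_Id])
  have f_nonneg: "0 \<le> f x" for x
    unfolding f_def using h_range by (simp add: sum_nonneg)
  have f_le: "f x \<le> 1" for x
    using sum_mono[of "{..<N}" "\<lambda>m. h m x" "\<lambda>_. 1"] h_range \<open>0 < real N\<close>
    by (simp add: f_def pos_divide_le_eq)
  have outside: "f x = 0" "G x = 0" if "x \<notin> nbhd B \<rho>" for x
  proof -
    have "x \<notin> nbhd B (\<delta> m)" for m using that nbhd_mono[OF \<delta>(2)] by blast
    then show "f x = 0" "G x = 0" unfolding f_def G_def using far by auto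
  qed
  have inside: "f x = 1" if "x \<in> nbhd B (\<delta> N)" for x
  proof -
    have "h m x = 1" if "m < N" for m
      using near \<open>x \<in> nbhd B (\<delta> N)\<close> that nbhd_mono[OF \<delta>_antimono[of "Suc m" N]] by auto
    then show ?thesis unfolding f_def using \<open>0 < real N\<close> by simp
  qed
  have G_bounded: "\<exists>M. \<forall>x. norm (G x) \<le> M"
  proof (intro exI allI)
    show "norm (G x) \<le> 1 / real N * (\<Sum>m<N. K / \<delta> m)" for x
      unfolding G_def norm_scaleR
      using norm_sum[of "\<lambda>m. g m x" "{..<N}"] sum_mono[of "{..<N}" "\<lambda>m. norm (g m x)" "\<lambda>m. K / \<delta> m"] g_le
      by (intro mult_mono) (auto intro: order_trans)
  qed
  define c where "c m = (1 / real N)\<^sup>2 * (K / \<delta> m)\<^sup>2 * \<delta> m powr \<gamma>" for m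
  have c_nonneg: "0 \<le> c m" for m by (simp add: c_def)
  have energy_le: "w x * (norm (G x))\<^sup>2 + (f x)\<^sup>2
      \<le> (\<Sum>m<N. c m * indicator (nbhd B (\<delta> m)) x) + indicator (nbhd B \<rho>) x" if "x \<in> \<Omega>" for x
  proof (rule add_mono)
    \<comment> \<open>Where \<open>g l\<close> is nonzero, the wider cutoff \<open>h m\<close> is constantly \<open>1\<close>.\<close>
    have disjoint: "g m x = 0 \<or> g l x = 0" if "m < l" for m l
      using near[of x m] far[of x l] nbhd_mono[OF \<delta>_antimono[of "Suc m" l], of B] that by auto
    have "(norm (\<Sum>m<N. g m x))\<^sup>2 = (\<Sum>m<N. (norm (g m x))\<^sup>2)"
      by (rule norm_sum_power2_if_at_most_one_nonzero) (use disjoint in \<open>auto simp: neq_iff\<close>)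
    then have "w x * (norm (G x))\<^sup>2 = (\<Sum>m<N. (1 / real N)\<^sup>2 * (w x * (norm (g m x))\<^sup>2))"
      by (simp add: G_def power_mult_distrib sum_distrib_left sum_divide_distrib power_divide)
    also have "\<dots> \<le> (\<Sum>m<N. c m * indicator (nbhd B (\<delta> m)) x)"
    proof (rule sum_mono)
      fix m
      show "(1 / real N)\<^sup>2 * (w x * (norm (g m x))\<^sup>2) \<le> c m * indicator (nbhd B (\<delta> m)) x"
      proof (cases "x \<in> nbhd B (\<delta> m)")
        case True
        have "w x * (norm (g m x))\<^sup>2 \<le> \<delta> m powr \<gamma> * (norm (g m x))\<^sup>2"
          using True \<open>x \<in> \<Omega>\<close> \<delta> by (intro mult_right_mono weight) auto
        also have "\<dots> \<le> \<delta> m powr \<gamma> * (K / \<delta> m)\<^sup>2"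
          by (intro mult_left_mono power_mono g_le) auto
        finally have "(1 / real N)\<^sup>2 * (w x * (norm (g m x))\<^sup>2)
            \<le> (1 / real N)\<^sup>2 * (\<delta> m powr \<gamma> * (K / \<delta> m)\<^sup>2)"
          by (intro mult_left_mono) auto
        then show ?thesis using True by (simp add: c_def mult_ac)
      qed (simp add: far)
    qed
    finally show "w x * (norm (G x))\<^sup>2 \<le> (\<Sum>m<N. c m * indicator (nbhd B (\<delta> m)) x)" .
    show "(f x)\<^sup>2 \<le> indicator (nbhd B \<rho>) x"
      using outside(1)[of x] f_nonneg[of x] f_le[of x]
      by (cases "x \<in> nbhd B \<rho>") (auto simp: power_le_one)
  qed
  have [measurable]: "nbhd B \<delta>' \<in> sets lebesgue" "\<Omega> \<in> sets lebesgue" for \<delta>'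
    using assms(1) by (auto simp: open_nbhd)
  have "(\<integral>\<^sup>+x\<in>\<Omega>. ennreal (w x * (norm (G x))\<^sup>2 + (f x)\<^sup>2) \<partial>lebesgue)
    \<le> (\<integral>\<^sup>+x. (\<Sum>m<N. ennreal (c m) * indicator (nbhd B (\<delta> m)) x) + indicator (\<Omega> \<inter> nbhd B \<rho>) x \<partial>lebesgue)"
  proof (rule nn_integral_mono)
    fix x
    show "ennreal (w x * (norm (G x))\<^sup>2 + (f x)\<^sup>2) * indicator \<Omega> x
      \<le> (\<Sum>m<N. ennreal (c m) * indicator (nbhd B (\<delta> m)) x) + indicator (\<Omega> \<inter> nbhd B \<rho>) x"
    proof (cases "x \<in> \<Omega>")
      case True
      have "ennreal (w x * (norm (G x))\<^sup>2 + (f x)\<^sup>2)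
        \<le> ennreal ((\<Sum>m<N. c m * indicator (nbhd B (\<delta> m)) x) + indicator (nbhd B \<rho>) x)"
        by (intro ennreal_leI energy_le True)
      also have "\<dots> = (\<Sum>m<N. ennreal (c m) * indicator (nbhd B (\<delta> m)) x) + indicator (nbhd B \<rho>) x"
        using c_nonneg by (simp add: ennreal_plus sum_nonneg ennreal_mult ennreal_indicator flip: sum_ennreal)
      finally show ?thesis using True by (simp add: indicator_def)
    qed simp
  qed
  also have "\<dots> = (\<integral>\<^sup>+x. (\<Sum>m<N. ennreal (c m) * indicator (nbhd B (\<delta> m)) x) \<partial>lebesgue)
      + (\<integral>\<^sup>+x. indicator (\<Omega> \<inter> nbhd B \<rho>) x \<partial>lebesgue)"
    by (rule nn_integral_add) measurable
  also have "(\<integral>\<^sup>+x. (\<Sum>m<N. ennreal (c m) * indicator (nbhd B (\<delta> m)) x) \<partial>lebesgue)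
      = (\<Sum>m<N. \<integral>\<^sup>+x. ennreal (c m) * indicator (nbhd B (\<delta> m)) x \<partial>lebesgue)"
    by (rule nn_integral_sum) measurable
  also have "\<dots> = (\<Sum>m<N. ennreal (c m) * emeasure lebesgue (nbhd B (\<delta> m)))"
    by (intro sum.cong refl nn_integral_cmult_indicator) measurable
  also have "(\<integral>\<^sup>+x. indicator (\<Omega> \<inter> nbhd B \<rho>) x \<partial>lebesgue) = emeasure lebesgue (\<Omega> \<inter> nbhd B \<rho>)"
    by (rule nn_integral_indicator) measurable
  also have "(\<Sum>m<N. ennreal (c m) * emeasure lebesgue (nbhd B (\<delta> m)))
      + emeasure lebesgue (\<Omega> \<inter> nbhd B \<rho>)
    \<le> (\<Sum>m<N. ennreal (K\<^sup>2 * b / (real N)\<^sup>2)) + ennreal (\<epsilon> / 2)"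
  proof (intro add_mono sum_mono)
    fix m
    have "c m * measure lebesgue (nbhd B (\<delta> m)) \<le> c m * (b * \<delta> m powr (2 - \<gamma>))"
      by (intro mult_left_mono volume \<delta> c_nonneg)
    also have "\<dots> = K\<^sup>2 * b / (real N)\<^sup>2 * (\<delta> m powr \<gamma> * \<delta> m powr (2 - \<gamma>) / (\<delta> m)\<^sup>2)"
      by (simp add: c_def power_divide)
    also have "\<delta> m powr \<gamma> * \<delta> m powr (2 - \<gamma>) = (\<delta> m)\<^sup>2"
      using \<delta>(1)[of m] by (simp flip: powr_add)
    finally have "c m * measure lebesgue (nbhd B (\<delta> m)) \<le> K\<^sup>2 * b / (real N)\<^sup>2"
      using \<delta>(1)[of m] by simp
    then show "ennreal (c m) * emeasure lebesgue (nbhd B (\<delta> m)) \<le> ennreal (K\<^sup>2 * b / (real N)\<^sup>2)"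
      by (simp add: emeasure_nbhd[OF assms(2)] c_nonneg ennreal_leI flip: ennreal_mult)
  qed (use n \<rho>_def in auto)
  also have "(\<Sum>m<N. ennreal (K\<^sup>2 * b / (real N)\<^sup>2)) = ennreal (\<Sum>m<N. K\<^sup>2 * b / (real N)\<^sup>2)"
    using assms(3) by (intro sum_ennreal) auto
  also have "(\<Sum>m<N. K\<^sup>2 * b / (real N)\<^sup>2) = K\<^sup>2 * b / real N"
    using \<open>0 < real N\<close> by (simp add: power2_eq_square)
  also have "ennreal (K\<^sup>2 * b / real N) + ennreal (\<epsilon> / 2) \<le> ennreal (\<epsilon> / 2) + ennreal (\<epsilon> / 2)"
    by (intro add_right_mono ennreal_leI N')
  also have "\<dots> = ennreal \<epsilon>" using assms(4) by (simp flip: ennreal_plus)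
  finally have energy: "(\<integral>\<^sup>+x\<in>\<Omega>. ennreal (w x * (norm (G x))\<^sup>2 + (f x)\<^sup>2) \<partial>lebesgue) \<le> ennreal \<epsilon>" .
  show ?thesis
    by (rule that[OF \<delta>(1)[of N] f_deriv f_nonneg inside _ _ G_bounded energy])
      (use outside nbhd_mono[OF \<rho>(2)] in blast)+
qed

section \<open>Locally finite sums of cutoff functions\<close>

text \<open>
  A version of the Cauchy-Schwarz inequality whose constants do not depend on the number of
  summands; it allows adding infinitely many functions whose energies decay fast enough.
\<close>

lemma norm_sum_power2_le_weighted:
  fixes v :: "nat \<Rightarrow> 'a::real_normed_vector"
  shows "(norm (\<Sum>k<n. v k))\<^sup>2 \<le> (\<Sum>k<n. 2 ^ Suc k * (norm (v k))\<^sup>2)"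
proof (induction n arbitrary: v)
  case (Suc n)
  define x where "x = norm (v 0)"
  define y where "y = norm (\<Sum>k<n. v (Suc k))"
  have "norm (\<Sum>k<Suc n. v k) \<le> x + y"
    unfolding x_def y_def sum.lessThan_Suc_shift by (rule norm_triangle_ineq)
  then have "(norm (\<Sum>k<Suc n. v k))\<^sup>2 \<le> (x + y)\<^sup>2" by (rule power_mono) simp
  also have "\<dots> \<le> 2 * x\<^sup>2 + 2 * y\<^sup>2"
    using zero_le_power2[of "x - y"] by (simp add: power2_eq_square algebra_simps)
  also have "y\<^sup>2 \<le> (\<Sum>k<n. 2 ^ Suc k * (norm (v (Suc k)))\<^sup>2)"
    unfolding y_def by (rule Suc.IH)
  finally show ?case
    by (simp add: x_def sum.lessThan_Suc_shift sum_distrib_left mult.assoc del: sum.lessThan_Suc)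
qed simp

text \<open>
  The sum \<open>F\<close> of the given functions is locally finite, hence differentiable, and at least \<open>1\<close>
  wherever one of them equals \<open>1\<close>; its truncation \<open>1 - pos_square (1 - F)\<close> is the desired function.
  The weighted bound on squares of sums gives the \<open>k\<close>-th energy the factor \<open>2 ^ (k + 1)\<close>, and the
  truncation at most a further \<open>4\<close>, so the total is at most
  \<open>\<Sum>k. 2 ^ (k + 3) * \<epsilon> / (16 * 4 ^ k) = \<epsilon>\<close>.
\<close>

lemma glue_locally_finite_cutoffs:
  fixes f :: "nat \<Rightarrow> real ^ 'n::finite \<Rightarrow> real" and w :: "real ^ 'n \<Rightarrow> real"
  assumes \<Omega>: "open \<Omega>" and \<epsilon>: "0 < \<epsilon>"
    and w: "w \<in> borel_measurable borel" "\<And>x. 0 \<le> w x"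
    and deriv: "\<And>k x. GDERIV (f k) x :> G k x" and nonneg: "\<And>k x. 0 \<le> f k x"
    and bounded: "\<And>k. \<exists>M. \<forall>x. norm (G k x) \<le> M"
    and local: "\<And>k x. norm x + 1 \<le> real k \<Longrightarrow> f k x = 0 \<and> G k x = 0"
    and energy: "\<And>k. (\<integral>\<^sup>+x\<in>\<Omega>. ennreal (w x * (norm (G k x))\<^sup>2 + (f k x)\<^sup>2) \<partial>lebesgue)
      \<le> ennreal (\<epsilon> / (16 * 4 ^ k))"
  obtains \<psi> \<Psi> where "\<And>x. GDERIV \<psi> x :> \<Psi> x" "\<And>r. \<exists>M. \<forall>x. norm x \<le> r \<longrightarrow> norm (\<Psi> x) \<le> M"
    "\<And>k x. f k x = 1 \<Longrightarrow> \<psi> x = 1"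
    "(\<integral>\<^sup>+x\<in>\<Omega>. ennreal (w x * (norm (\<Psi> x))\<^sup>2 + (\<psi> x)\<^sup>2) \<partial>lebesgue) \<le> ennreal \<epsilon>"
proof -
  define F where "F x = (\<Sum>k. f k x)" for x
  define D where "D x = (\<Sum>k. G k x)" for x
  have F_eq: "F x = (\<Sum>k<Suc n. f k x)" and D_eq: "D x = (\<Sum>k<Suc n. G k x)"
    if "norm x \<le> real n" for x n
  proof -
    have "f k x = 0 \<and> G k x = 0" if "k \<notin> {..<Suc n}" for k
    proof (rule local)
      have "real (Suc n) \<le> real k" using that by (simp only: of_nat_le_iff lessThan_iff not_less)
      then show "norm x + 1 \<le> real k" using \<open>norm x \<le> real n\<close> by simp
    qed
    then show "F x = (\<Sum>k<Suc n. f k x)" "D x = (\<Sum>k<Suc n. G k x)"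
      unfolding F_def D_def by (intro suminf_finite; blast)+
  qed
  have F_deriv: "GDERIV F x :> D x" for x
  proof -
    obtain n where n: "norm x < real n" using reals_Archimedean2 by blast
    have "((\<lambda>y. \<Sum>k<Suc n. f k y) has_derivative (\<lambda>h. h \<bullet> D x)) (at x)"
      using GDERIV_sum[where I = "{..<Suc n}" and f = f and g = "\<lambda>k. G k x", OF deriv] D_eq[of x n] n
      by (simp add: gderiv_def)
    then show ?thesis
      unfolding gderiv_def
      by (rule has_derivative_transform_within_open[where s = "ball 0 (real n)"])
        (use n F_eq[of _ n] in auto)
  qed
  have F_nonneg: "0 \<le> F x" for x
  proof -
    obtain n where "norm x < real n" using reals_Archimedean2 by blast
    then show ?thesis using nonneg by (subst F_eq[of x n]) (auto intro: sum_nonneg simp del: sum.lessThan_Suc)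
  qed
  define \<psi> where "\<psi> x = 1 - pos_square (1 - F x)" for x
  define \<Psi> where "\<Psi> x = (2 * max 0 (1 - F x)) *\<^sub>R D x" for x
  have "GDERIV (\<lambda>x. 1 - pos_square (1 - F x)) x
      :> (- (2 * max 0 (1 - F x) * - 1)) *\<^sub>R D x" for x
    by (rule GDERIV_DERIV_compose[OF F_deriv])
      (auto intro!: derivative_eq_intros DERIV_pos_square[THEN DERIV_chain2])
  then have \<psi>_deriv: "GDERIV \<psi> x :> \<Psi> x" for x unfolding \<psi>_def \<Psi>_def by simp
  have \<Psi>_le: "norm (\<Psi> x) \<le> 2 * norm (D x)" for x
    unfolding \<Psi>_def norm_scaleR using F_nonneg[of x] by (intro mult_right_mono) auto
  have \<psi>_le: "0 \<le> \<psi> x" "\<psi> x \<le> 2 * F x" for x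
  proof -
    show "0 \<le> \<psi> x" using F_nonneg[of x] pos_square_simps(3)[of "1 - F x"] by (simp add: \<psi>_def)
    show "\<psi> x \<le> 2 * F x"
      unfolding \<psi>_def pos_square_def using F_nonneg[of x]
      by (cases "F x \<le> 1") (auto simp: max_def power2_eq_square algebra_simps)
  qed
  have \<Psi>_bounded: "\<exists>M. \<forall>x. norm x \<le> r \<longrightarrow> norm (\<Psi> x) \<le> M" for r
  proof -
    obtain M where M: "\<And>k x. norm (G k x) \<le> M k" using bounded by metis
    obtain n where n: "r < real n" using reals_Archimedean2 by blast
    have "norm (\<Psi> x) \<le> 2 * (\<Sum>k<Suc n. M k)" if "norm x \<le> r" for x
    proof -
      have "norm (D x) \<le> (\<Sum>k<Suc n. M k)"
        using that n by (subst D_eq[of x n]) (auto intro: sum_norm_le M simp del: sum.lessThan_Suc)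
      then show ?thesis using \<Psi>_le[of x] by linarith
    qed
    then show ?thesis by blast
  qed
  have \<psi>_one: "\<psi> x = 1" if one: "f k x = 1" for k x
  proof -
    obtain n where n: "norm x < real n" using reals_Archimedean2 by blast
    have "k < Suc n"
    proof (rule ccontr)
      assume "\<not> k < Suc n"
      then have "f k x = 0" using local[of x k] n by simp
      with one show False by simp
    qed
    then have "f k x \<le> (\<Sum>k<Suc n. f k x)" by (intro member_le_sum nonneg) auto
    then have "1 \<le> F x" using one n by (subst F_eq[of x n]) (auto simp del: sum.lessThan_Suc)
    then show ?thesis by (simp add: \<psi>_def pos_square_simps)
  qed
  define e where "e k x = w x * (norm (G k x))\<^sup>2 + (f k x)\<^sup>2" for k x
  have e_nonneg: "0 \<le> e k x" for k x by (simp add: e_def w)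
  have pointwise: "ennreal (w x * (norm (\<Psi> x))\<^sup>2 + (\<psi> x)\<^sup>2)
      \<le> (\<Sum>k. ennreal (2 ^ (k + 3)) * ennreal (e k x))" for x
  proof -
    obtain n where n: "norm x < real n" using reals_Archimedean2 by blast
    have "(norm (\<Psi> x))\<^sup>2 \<le> (2 * norm (D x))\<^sup>2" by (intro power_mono \<Psi>_le) auto
    also have "(2 * norm (D x))\<^sup>2 \<le> 4 * (\<Sum>k<Suc n. 2 ^ Suc k * (norm (G k x))\<^sup>2)"
      using norm_sum_power2_le_weighted[of "\<lambda>k. G k x" "Suc n"] D_eq[of x n] n
      by (simp add: power_mult_distrib del: sum.lessThan_Suc)
    finally have 1: "w x * (norm (\<Psi> x))\<^sup>2 \<le> w x * (4 * (\<Sum>k<Suc n. 2 ^ Suc k * (norm (G k x))\<^sup>2))"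
      by (intro mult_left_mono w)
    have "(\<psi> x)\<^sup>2 \<le> (2 * F x)\<^sup>2" by (intro power_mono \<psi>_le)
    also have "\<dots> \<le> 4 * (\<Sum>k<Suc n. 2 ^ Suc k * (f k x)\<^sup>2)"
      using norm_sum_power2_le_weighted[of "\<lambda>k. f k x" "Suc n"] F_eq[of x n] n
      by (simp add: power_mult_distrib del: sum.lessThan_Suc)
    finally have "w x * (norm (\<Psi> x))\<^sup>2 + (\<psi> x)\<^sup>2 \<le> w x * (4 * (\<Sum>k<Suc n. 2 ^ Suc k * (norm (G k x))\<^sup>2))
      + 4 * (\<Sum>k<Suc n. 2 ^ Suc k * (f k x)\<^sup>2)" using 1 by linarith
    also have "\<dots> = (\<Sum>k<Suc n. 2 ^ (k + 3) * e k x)"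
      unfolding e_def sum_distrib_left sum.distrib[symmetric]
      by (intro sum.cong refl) (simp add: algebra_simps power_add)
    finally have "ennreal (w x * (norm (\<Psi> x))\<^sup>2 + (\<psi> x)\<^sup>2) \<le> ennreal (\<Sum>k<Suc n. 2 ^ (k + 3) * e k x)"
      by (rule ennreal_leI)
    also have "\<dots> = (\<Sum>k<Suc n. ennreal (2 ^ (k + 3) * e k x))"
      using e_nonneg by (intro sum_ennreal[symmetric]) auto
    also have "\<dots> = (\<Sum>k<Suc n. ennreal (2 ^ (k + 3)) * ennreal (e k x))"
      using e_nonneg by (intro sum.cong refl ennreal_mult) auto
    also have "\<dots> \<le> (\<Sum>k. ennreal (2 ^ (k + 3)) * ennreal (e k x))"
      by (intro sum_le_suminf) auto
    finally show ?thesis .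
  qed
  have [measurable]: "e k \<in> borel_measurable lebesgue" for k
  proof -
    have "continuous_on UNIV (f k)"
      using deriv GDERIV_imp_isCont continuous_at_imp_continuous_on by blast
    then have [measurable]: "f k \<in> borel_measurable borel" by (rule borel_measurable_continuous_onI)
    have [measurable]: "G k \<in> borel_measurable borel" using deriv by (rule borel_measurable_GDERIV)
    note w(1) [measurable]
    have "e k \<in> borel_measurable borel" unfolding e_def by measurable
    then show ?thesis by (rule borel_measurable_completion)
  qed
  have [measurable]: "\<Omega> \<in> sets lebesgue" using \<Omega> by auto
  have "(\<integral>\<^sup>+x\<in>\<Omega>. ennreal (w x * (norm (\<Psi> x))\<^sup>2 + (\<psi> x)\<^sup>2) \<partial>lebesgue)
      \<le> (\<integral>\<^sup>+x. (\<Sum>k. ennreal (2 ^ (k + 3)) * (ennreal (e k x) * indicator \<Omega> x)) \<partial>lebesgue)"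
    using pointwise by (intro nn_integral_mono) (auto simp: indicator_def)
  also have "\<dots> = (\<Sum>k. \<integral>\<^sup>+x. ennreal (2 ^ (k + 3)) * (ennreal (e k x) * indicator \<Omega> x) \<partial>lebesgue)"
    by (rule nn_integral_suminf) measurable
  also have "\<dots> = (\<Sum>k. ennreal (2 ^ (k + 3)) * (\<integral>\<^sup>+x\<in>\<Omega>. ennreal (e k x) \<partial>lebesgue))"
    by (intro suminf_cong nn_integral_cmult) measurable
  also have "\<dots> \<le> (\<Sum>k. ennreal (2 ^ (k + 3)) * ennreal (\<epsilon> / (16 * 4 ^ k)))"
    using energy by (intro suminf_le mult_left_mono) (auto simp: e_def)
  also have "\<dots> = (\<Sum>k. ennreal (\<epsilon> * (1 / 2) ^ Suc k))"
  proof (rule suminf_cong)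
    fix k :: nat
    have "(4::real) ^ k = 2 ^ k * 2 ^ k" by (simp flip: power_mult_distrib)
    then have "2 ^ (k + 3) * (\<epsilon> / (16 * 4 ^ k)) = \<epsilon> * (1 / 2) ^ Suc k"
      by (simp add: power_add power_divide)
    then show "ennreal (2 ^ (k + 3)) * ennreal (\<epsilon> / (16 * 4 ^ k)) = ennreal (\<epsilon> * (1 / 2) ^ Suc k)"
      using \<epsilon> by (simp flip: ennreal_mult)
  qed
  also have "\<dots> = ennreal \<epsilon>"
    using sums_mult[OF power_half_series, of \<epsilon>] \<epsilon>
    by (subst suminf_ennreal2) (auto simp: sums_iff)
  finally have small: "(\<integral>\<^sup>+x\<in>\<Omega>. ennreal (w x * (norm (\<Psi> x))\<^sup>2 + (\<psi> x)\<^sup>2) \<partial>lebesgue) \<le> ennreal \<epsilon>" .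
  show ?thesis by (rule that[OF \<psi>_deriv \<Psi>_bounded _ small]) (rule \<psi>_one)
qed

section \<open>Bounding the capacity by one competitor\<close>

lemma quadratic_form_eq:
  fixes v :: "real ^ 'n::finite"
  shows "(\<Sum>i\<in>UNIV. \<Sum>j\<in>UNIV. M $ i $ j * v $ i * v $ j) = v \<bullet> (M *v v)"
  by (simp add: inner_vec_def matrix_vector_mult_def sum_distrib_left mult_ac)

lemma cap_le:
  fixes \<Omega> A :: "(real ^ 'n::finite) set"
  assumes "open \<Omega>" "0 < a" "\<And>x. 0 \<le> w x" and [measurable]: "w \<in> borel_measurable borel"
    and form: "AE x in lebesgue. x \<in> \<Omega> \<longrightarrow> (\<forall>v. v \<bullet> (C x *v v) \<le> a * w x * (v \<bullet> v))"
    and deriv: "\<And>x. GDERIV \<psi> x :> \<Psi> x"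
    and bounded: "\<And>r. \<exists>M. \<forall>x. norm x \<le> r \<longrightarrow> norm (\<Psi> x) \<le> M"
    and U: "open U" "A \<subseteq> U" "\<And>x. x \<in> U \<Longrightarrow> \<psi> x = 1"
    and energy: "(\<integral>\<^sup>+x\<in>\<Omega>. ennreal (w x * (norm (\<Psi> x))\<^sup>2 + (\<psi> x)\<^sup>2) \<partial>lebesgue) \<le> ennreal \<epsilon>"
    and "0 \<le> \<epsilon>"
  shows "cap \<Omega> C A \<le> ennreal ((a + 1) * \<epsilon>)"
proof -
  let ?e = "\<lambda>x. ennreal (w x * (norm (\<Psi> x))\<^sup>2 + (\<psi> x)\<^sup>2)"
  have "continuous_on UNIV \<psi>"
    using deriv GDERIV_imp_isCont continuous_at_imp_continuous_on by blast
  then have [measurable]: "\<psi> \<in> borel_measurable borel" by (rule borel_measurable_continuous_onI)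
  have [measurable]: "\<Psi> \<in> borel_measurable borel" using deriv by (rule borel_measurable_GDERIV)
  have \<Omega> [measurable]: "\<Omega> \<in> sets borel" using assms(1) by auto
  have L2: "L2_norm_sq \<Omega> \<psi> \<le> ennreal \<epsilon>"
  proof -
    have "L2_norm_sq \<Omega> \<psi> \<le> (\<integral>\<^sup>+x\<in>\<Omega>. ?e x \<partial>lebesgue)"
      unfolding L2_norm_sq_def using assms(3)
      by (intro nn_integral_mono mult_right_mono ennreal_leI) auto
    with energy show ?thesis by (rule order_trans[rotated])
  qed
  have form': "l_form \<Omega> C \<psi> \<le> ennreal (a * \<epsilon>)"
  proof -
    have "l_form \<Omega> C \<psi> \<le> (\<integral>\<^sup>+x\<in>\<Omega>. ennreal (\<Sum>i\<in>UNIV. \<Sum>j\<in>UNIV. C x $ i $ j * \<Psi> x $ i * \<Psi> x $ j) \<partial>lebesgue)"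
      unfolding l_form_def
      by (rule INF_lower) (use has_weak_gradient_if_GDERIV[OF deriv bounded] in simp)
    also have "\<dots> \<le> (\<integral>\<^sup>+x. ennreal a * (?e x * indicator \<Omega> x) \<partial>lebesgue)"
    proof (rule nn_integral_mono_AE, use form in eventually_elim)
      fix x assume x: "x \<in> \<Omega> \<longrightarrow> (\<forall>v. v \<bullet> (C x *v v) \<le> a * w x * (v \<bullet> v))"
      show "ennreal (\<Sum>i\<in>UNIV. \<Sum>j\<in>UNIV. C x $ i $ j * \<Psi> x $ i * \<Psi> x $ j) * indicator \<Omega> x
          \<le> ennreal a * (?e x * indicator \<Omega> x)"
      proof (cases "x \<in> \<Omega>")
        case True
        have "\<Psi> x \<bullet> (C x *v \<Psi> x) \<le> a * w x * (\<Psi> x \<bullet> \<Psi> x)" using x True by blast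
        also have "\<dots> = a * (w x * (norm (\<Psi> x))\<^sup>2)" by (simp add: power2_norm_eq_inner)
        also have "\<dots> \<le> a * (w x * (norm (\<Psi> x))\<^sup>2 + (\<psi> x)\<^sup>2)"
          using assms(2) by (intro mult_left_mono) auto
        finally have "ennreal (\<Psi> x \<bullet> (C x *v \<Psi> x)) \<le> ennreal a * ?e x"
          using assms(2,3) by (subst ennreal_mult[symmetric]) (auto intro: ennreal_leI)
        then show ?thesis using True by (simp add: quadratic_form_eq)
      qed simp
    qed
    also have "\<dots> = ennreal a * (\<integral>\<^sup>+x\<in>\<Omega>. ?e x \<partial>lebesgue)"
    proof (rule nn_integral_cmult)
      have "(\<lambda>x. ?e x * indicator \<Omega> x) \<in> borel_measurable borel" by measurable
      then show "(\<lambda>x. ?e x * indicator \<Omega> x) \<in> borel_measurable lebesgue"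
        by (rule borel_measurable_completion)
    qed
    also have "\<dots> \<le> ennreal a * ennreal \<epsilon>"
      using energy by (rule mult_left_mono) simp
    finally show ?thesis using assms(2) by (simp add: ennreal_mult')
  qed
  have "\<psi> \<in> l_domain \<Omega> C"
  proof -
    have "\<psi> \<in> borel_measurable lebesgue" by (rule borel_measurable_completion) simp
    then have "set_borel_measurable lebesgue \<Omega> \<psi>"
      unfolding set_borel_measurable_def using \<Omega> by (intro borel_measurable_scaleR borel_measurable_indicator) auto
    then show ?thesis
      unfolding l_domain_def L2_space_def
      using order_le_less_trans[OF L2, of \<infinity>] order_le_less_trans[OF form', of \<infinity>] by simp
  qed
  then have "cap \<Omega> C A \<le> l_form \<Omega> C \<psi> + L2_norm_sq \<Omega> \<psi>"
    unfolding cap_def using U by (intro INF_lower) auto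
  also have "\<dots> \<le> ennreal (a * \<epsilon>) + ennreal \<epsilon>" using form' L2 by (rule add_mono)
  also have "\<dots> = ennreal ((a + 1) * \<epsilon>)"
    using assms by (simp add: algebra_simps flip: ennreal_plus)
  finally show ?thesis .
qed

section \<open>Minkowski dimension and volume of neighbourhoods\<close>

lemma card_mem_minkowski_exponents:
  fixes B :: "(real ^ 'n::finite) set"
  assumes "bounded B"
  shows "real CARD('n) \<in> minkowski_exponents B"
proof -
  define b where "b = measure lebesgue (nbhd B 1) + 1"
  have "measure lebesgue (nbhd B \<delta>) \<le> b * \<delta> powr (real CARD('n) - real CARD('n))" if "\<delta> \<in> {0<..1}" for \<delta>
  proof -
    have "measure lebesgue (nbhd B \<delta>) \<le> measure lebesgue (nbhd B 1)"
      using that nbhd_mono[of \<delta> 1 B]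
      by (intro measure_mono_fmeasurable fmeasurableI) (auto simp: open_nbhd emeasure_nbhd[OF assms])
    then show ?thesis using that by (simp add: b_def)
  qed
  moreover have "0 < b" by (simp add: b_def add_nonneg_pos)
  ultimately show ?thesis unfolding minkowski_exponents_def by auto
qed

lemma minkowski_exponents_upward_closed:
  fixes B :: "(real ^ 'n::finite) set"
  assumes "s \<in> minkowski_exponents B" "s \<le> t"
  shows "t \<in> minkowski_exponents B"
proof -
  obtain b where b: "0 \<le> s" "0 < b"
    "\<And>\<delta>. \<delta> \<in> {0<..1} \<Longrightarrow> measure lebesgue (nbhd B \<delta>) \<le> b * \<delta> powr (real CARD('n) - s)"
    using assms(1) unfolding minkowski_exponents_def by blast
  have "measure lebesgue (nbhd B \<delta>) \<le> b * \<delta> powr (real CARD('n) - t)" if "\<delta> \<in> {0<..1}" for \<delta>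
  proof -
    have "\<delta> powr (real CARD('n) - s) \<le> \<delta> powr (real CARD('n) - t)"
      using that assms(2) by (intro powr_mono') auto
    then have "b * \<delta> powr (real CARD('n) - s) \<le> b * \<delta> powr (real CARD('n) - t)"
      using b(2) by (intro mult_left_mono) auto
    with b(3)[OF that] show ?thesis by linarith
  qed
  with b assms(2) show ?thesis unfolding minkowski_exponents_def by auto
qed

text \<open>
  With \<open>d\<close> the dimension of the space, the bound says that \<open>s = \<gamma> + d - 2\<close> is an exponent of \<open>B\<close>.
  Since \<open>s\<close> is at least the dimension of \<open>A\<close>, it is at least that of \<open>B\<close>. If it is larger, it lies
  above some exponent of \<open>B\<close>; if it is equal, both dimensions agree with \<open>s\<close> and the infimum is
  attained.
\<close>

lemma nbhd_volume_le:
  fixes A B :: "(real ^ 'n::finite) set"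
  assumes B: "B \<in> bounded_measurable_subsets A"
    and \<gamma>: "2 - (real CARD('n) - set_dimension A) \<le> \<gamma>"
    and attained: "\<gamma> = 2 - (real CARD('n) - set_dimension A) \<Longrightarrow> dimension_attained A"
  obtains b where "0 < b"
    "\<And>\<delta>. 0 < \<delta> \<Longrightarrow> \<delta> \<le> 1 \<Longrightarrow> measure lebesgue (nbhd B \<delta>) \<le> b * \<delta> powr (2 - \<gamma>)"
proof -
  have bdd: "bdd_below (minkowski_exponents X)" for X :: "(real ^ 'n) set"
    unfolding minkowski_exponents_def by (rule bdd_belowI[of _ 0]) auto
  have "minkowski_dim X \<le> real CARD('n)" if "X \<in> bounded_measurable_subsets A" for X
    unfolding minkowski_dim_def using that bdd card_mem_minkowski_exponents
    by (intro cInf_lower) (auto simp: bounded_measurable_subsets_def)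
  then have "bdd_above (minkowski_dim ` bounded_measurable_subsets A)"
    by (intro bdd_aboveI[of _ "real CARD('n)"]) auto
  then have dim_le: "minkowski_dim B \<le> set_dimension A"
    unfolding set_dimension_def using B by (intro cSUP_upper)
  have "minkowski_exponents B \<noteq> {}"
    using card_mem_minkowski_exponents B by (auto simp: bounded_measurable_subsets_def)
  define s where "s = \<gamma> + real CARD('n) - 2"
  have "s \<in> minkowski_exponents B"
  proof (cases "minkowski_dim B < s")
    case True
    then obtain t where "t \<in> minkowski_exponents B" "t < s"
      unfolding minkowski_dim_def using cInf_lessD[OF \<open>minkowski_exponents B \<noteq> {}\<close>] by blast
    then show ?thesis using minkowski_exponents_upward_closed by fastforce
  next
    case False
    then have "minkowski_dim B = s" "set_dimension A = s" using dim_le \<gamma> by (auto simp: s_def)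
    moreover have "dimension_attained A"
      using \<open>set_dimension A = s\<close> by (intro attained) (simp add: s_def)
    ultimately show ?thesis using B unfolding dimension_attained_def by auto
  qed
  then show ?thesis using that unfolding minkowski_exponents_def s_def by (auto simp: algebra_simps)
qed

section \<open>Sets of zero capacity\<close>

lemma degeneracy_weight_nonneg: "0 \<le> degeneracy_weight A \<gamma> x"
  by (simp add: degeneracy_weight_def)

lemma borel_measurable_degeneracy_weight: "degeneracy_weight A \<gamma> \<in> borel_measurable borel"
proof -
  have [measurable]: "(\<lambda>x. infdist x A) \<in> borel_measurable borel"
    by (intro borel_measurable_continuous_onI continuous_intros)
  show ?thesis unfolding degeneracy_weight_def by measurable
qed

lemma degeneracy_weight_le:
  assumes "B \<subseteq> A" "x \<in> nbhd B \<delta>" "0 < \<delta>" "0 \<le> \<gamma>"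
  shows "degeneracy_weight A \<gamma> x \<le> \<delta> powr \<gamma>"
proof (cases "\<gamma> = 0")
  case True
  then show ?thesis using assms(3) by (simp add: degeneracy_weight_def)
next
  case False
  have "B \<noteq> {}" "infdist x B < \<delta>" using assms(2) by (auto simp: nbhd_def)
  moreover from this have "infdist x A \<le> infdist x B" using assms(1) by (intro infdist_mono)
  ultimately have "min (infdist x A) 1 powr \<gamma> \<le> \<delta> powr \<gamma>"
    using assms(4) by (intro powr_mono2) (auto simp: infdist_nonneg)
  then show ?thesis using False \<open>B \<noteq> {}\<close> assms(1) by (auto simp: degeneracy_weight_def)
qed

text \<open>
  \<open>A\<close> need not be bounded, so it is cut into the pieces \<open>B k\<close> in the annuli \<open>k \<le> |x| < k + 1\<close>. Their
  unit neighbourhoods form a locally finite family, so logarithmic cutoffs for the pieces can be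
  glued to a function that equals \<open>1\<close> near \<open>A\<close> and has arbitrarily small energy.
  
  The cutoffs require that \<open>closure (B k)\<close> meets \<open>\<Omega>\<close> in a null set, which has two different reasons.
  If \<open>\<gamma> > 0\<close>, the weight vanishes on \<open>closure A\<close>, while the coefficients are positive in \<open>\<Omega>\<close>. If \<open>\<gamma> = 0\<close>,
  the neighbourhoods of \<open>B k\<close> of radius \<open>\<delta>\<close> have volume at most of order \<open>\<delta>\<^sup>2\<close>.
\<close>

lemma cap_eq_0_if_degenerate:
  fixes \<Omega> A :: "(real ^ 'n::finite) set" and C :: "real ^ 'n \<Rightarrow> real ^ 'n ^ 'n"
  assumes \<Omega>: "open \<Omega>" and a: "0 < a" and \<gamma>0: "0 \<le> \<gamma>" and A: "A \<in> sets lebesgue"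
    and pos: "\<And>x v. x \<in> \<Omega> \<Longrightarrow> v \<noteq> 0 \<Longrightarrow> 0 < v \<bullet> (C x *v v)"
    and form: "AE x in lebesgue. x \<in> \<Omega> \<longrightarrow>
      (\<forall>v. v \<bullet> (C x *v v) \<le> a * degeneracy_weight A \<gamma> x * (v \<bullet> v))"
    and \<gamma>: "2 - (real CARD('n) - set_dimension A) \<le> \<gamma>"
    and attained: "\<gamma> = 2 - (real CARD('n) - set_dimension A) \<Longrightarrow> dimension_attained A"
  shows "cap \<Omega> C A = 0"
proof -
  let ?w = "degeneracy_weight A \<gamma>"
  define B where "B k = A \<inter> {x. real k \<le> norm x \<and> norm x < real (Suc k)}" for k :: nat
  have B_sub: "B k \<subseteq> A" for k by (auto simp: B_def)
  have B_bounded: "bounded (B k)" for k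
    by (rule boundedI[of _ "real (Suc k)"]) (auto simp: B_def)
  have B: "B k \<in> bounded_measurable_subsets A" for k
  proof -
    have "{x :: real ^ 'n. real k \<le> norm x \<and> norm x < real (Suc k)} \<in> sets borel" by measurable
    then have "B k \<in> sets lebesgue" unfolding B_def using A by (intro sets.Int) auto
    then show ?thesis using B_sub B_bounded by (simp add: bounded_measurable_subsets_def)
  qed
  have null: "emeasure lebesgue (\<Omega> \<inter> closure (B k)) = 0" for k
  proof (cases "\<gamma> = 0")
    case True
    obtain b where b: "0 < b"
      "\<And>\<delta>. 0 < \<delta> \<Longrightarrow> \<delta> \<le> 1 \<Longrightarrow> measure lebesgue (nbhd (B k) \<delta>) \<le> b * \<delta> powr (2 - \<gamma>)"
      using nbhd_volume_le[OF B \<gamma> attained] by blast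
    have "emeasure lebesgue (\<Omega> \<inter> closure (B k)) \<le> 0"
    proof (rule ennreal_le_epsilon)
      fix e :: real assume "0 < e"
      define \<delta> where "\<delta> = min 1 (e / b)"
      have \<delta>: "0 < \<delta>" "\<delta> \<le> 1" "b * \<delta> \<le> e"
        using \<open>0 < e\<close> b(1) by (auto simp: \<delta>_def min_def field_simps)
      have "\<Omega> \<inter> closure (B k) \<subseteq> nbhd (B k) \<delta>"
      proof
        fix x assume "x \<in> \<Omega> \<inter> closure (B k)"
        then show "x \<in> nbhd (B k) \<delta>"
          using \<delta>(1) in_closure_iff_infdist_zero[of "B k" x] by (cases "B k = {}") (auto simp: nbhd_def)
      qed
      then have "emeasure lebesgue (\<Omega> \<inter> closure (B k)) \<le> emeasure lebesgue (nbhd (B k) \<delta>)"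
        by (rule emeasure_mono) (auto simp: open_nbhd)
      also have "\<dots> = ennreal (measure lebesgue (nbhd (B k) \<delta>))" by (rule emeasure_nbhd[OF B_bounded])
      also have "measure lebesgue (nbhd (B k) \<delta>) \<le> b * \<delta>\<^sup>2"
        using b(2)[OF \<delta>(1,2)] True \<delta>(1) by simp
      also have "b * \<delta>\<^sup>2 \<le> b * \<delta>"
        using b(1) \<delta> by (intro mult_left_mono) (auto simp: power2_eq_square mult_le_one)
      also have "b * \<delta> \<le> e" by (rule \<delta>)
      finally show "emeasure lebesgue (\<Omega> \<inter> closure (B k)) \<le> 0 + ennreal e"
        by (simp add: ennreal_leI)
    qed
    then show ?thesis by simp
  next
    case False
    have "AE x in lebesgue. \<not> (x \<in> \<Omega> \<inter> closure (B k))"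
      using form
    proof eventually_elim
      case (elim x)
      show ?case
      proof
        assume x: "x \<in> \<Omega> \<inter> closure (B k)"
        then have "A \<noteq> {}" "x \<in> closure A" using B_sub[of k] closure_mono[of "B k" A] by auto
        then have "infdist x A = 0" by (simp add: in_closure_iff_infdist_zero)
        then have "?w x = 0" using False \<open>A \<noteq> {}\<close> by (simp add: degeneracy_weight_def)
        define v where "v = (axis undefined 1 :: real ^ 'n)"
        have "v \<noteq> 0" by (simp add: v_def axis_eq_0_iff)
        then have "0 < v \<bullet> (C x *v v)" using pos x by blast
        with elim x \<open>?w x = 0\<close> show False by (metis IntD1 less_le_not_le mult_zero_left mult_zero_right)
      qed
    qed
    from emeasure_eq_0_AE[OF this] show ?thesis by (simp add: Int_def)
  qed
  have "cap \<Omega> C A \<le> 0"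
  proof (rule ennreal_le_epsilon)
    fix \<eta> :: real assume "0 < \<eta>"
    \<comment> \<open>The form contributes \<open>a \<epsilon>\<close> and the norm contributes \<open>\<epsilon>\<close>.\<close>
    define \<epsilon> where "\<epsilon> = \<eta> / (a + 1)"
    have \<epsilon>: "0 < \<epsilon>" "(a + 1) * \<epsilon> = \<eta>" using \<open>0 < \<eta>\<close> a by (auto simp: \<epsilon>_def)
    define cutoff where "cutoff k f G r \<longleftrightarrow> 0 < r \<and> (\<forall>x. GDERIV f x :> G x) \<and> (\<forall>x. 0 \<le> f x)
        \<and> (\<forall>x\<in>nbhd (B k) r. f x = 1) \<and> (\<forall>x. x \<notin> nbhd (B k) 1 \<longrightarrow> f x = 0 \<and> G x = 0)
        \<and> (\<exists>M. \<forall>x. norm (G x) \<le> M)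
        \<and> (\<integral>\<^sup>+x\<in>\<Omega>. ennreal (?w x * (norm (G x))\<^sup>2 + (f x)\<^sup>2) \<partial>lebesgue) \<le> ennreal (\<epsilon> / (16 * 4 ^ k))"
      for k f G r
    have "\<exists>f G r. cutoff k f G r" for k
    proof -
      obtain b where b: "0 < b"
        "\<And>\<delta>. 0 < \<delta> \<Longrightarrow> \<delta> \<le> 1 \<Longrightarrow> measure lebesgue (nbhd (B k) \<delta>) \<le> b * \<delta> powr (2 - \<gamma>)"
        using nbhd_volume_le[OF B \<gamma> attained] by blast
      have "0 < \<epsilon> / (16 * 4 ^ k)" using \<epsilon> by simp
      moreover have "?w x \<le> \<delta> powr \<gamma>" if "0 < \<delta>" "\<delta> \<le> 1" "x \<in> \<Omega> \<inter> nbhd (B k) \<delta>" for x \<delta>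
        using that \<gamma>0 B_sub by (intro degeneracy_weight_le[of "B k"]) auto
      ultimately show ?thesis unfolding cutoff_def
        by (rule logarithmic_cutoff[OF \<Omega> B_bounded b(1) _ _ b(2) null]) blast+
    qed
    then obtain f G r where cutoff: "\<And>k. cutoff k (f k) (G k) (r k)" by metis
    have r: "0 < r k" and deriv: "GDERIV (f k) x :> G k x" and nonneg: "0 \<le> f k x"
      and one: "x \<in> nbhd (B k) (r k) \<Longrightarrow> f k x = 1"
      and far: "x \<notin> nbhd (B k) 1 \<Longrightarrow> f k x = 0 \<and> G k x = 0"
      and bounded: "\<exists>M. \<forall>x. norm (G k x) \<le> M"
      and energy: "(\<integral>\<^sup>+x\<in>\<Omega>. ennreal (?w x * (norm (G k x))\<^sup>2 + (f k x)\<^sup>2) \<partial>lebesgue)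
        \<le> ennreal (\<epsilon> / (16 * 4 ^ k))" for k x
      using cutoff[of k] by (simp_all add: cutoff_def)
    have local: "f k x = 0 \<and> G k x = 0" if x: "norm x + 1 \<le> real k" for k x
    proof (rule far)
      have False if y: "y \<in> B k" "dist x y < 1" for y
        using x y norm_triangle_sub[of y x] by (simp add: B_def dist_norm norm_minus_commute)
      then show "x \<notin> nbhd (B k) 1" unfolding nbhd_iff by blast
    qed
    obtain \<psi> \<Psi> where \<psi>: "\<And>x. GDERIV \<psi> x :> \<Psi> x" "\<And>r. \<exists>M. \<forall>x. norm x \<le> r \<longrightarrow> norm (\<Psi> x) \<le> M"
      "\<And>k x. f k x = 1 \<Longrightarrow> \<psi> x = 1"
      "(\<integral>\<^sup>+x\<in>\<Omega>. ennreal (?w x * (norm (\<Psi> x))\<^sup>2 + (\<psi> x)\<^sup>2) \<partial>lebesgue) \<le> ennreal \<epsilon>"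
      by (rule glue_locally_finite_cutoffs[OF \<Omega> \<epsilon>(1) borel_measurable_degeneracy_weight
            degeneracy_weight_nonneg deriv nonneg bounded local energy]) (assumption, rule that)
    have "cap \<Omega> C A \<le> ennreal ((a + 1) * \<epsilon>)"
    proof (rule cap_le[OF \<Omega> a degeneracy_weight_nonneg borel_measurable_degeneracy_weight form \<psi>(1,2)])
      show "open (\<Union>k. nbhd (B k) (r k))" by (intro open_UN ballI open_nbhd)
      show "A \<subseteq> (\<Union>k. nbhd (B k) (r k))"
      proof
        fix x assume "x \<in> A"
        define k where "k = nat \<lfloor>norm x\<rfloor>"
        have "x \<in> B k" using \<open>x \<in> A\<close> unfolding B_def k_def by simp linarith
        then show "x \<in> (\<Union>k. nbhd (B k) (r k))" using subset_nbhd[OF r] by blast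
      qed
      show "\<psi> x = 1" if "x \<in> (\<Union>k. nbhd (B k) (r k))" for x
        using that \<psi>(3) one by blast
    qed (use \<psi>(4) \<epsilon>(1) in auto)
    then show "cap \<Omega> C A \<le> 0 + ennreal \<eta>" using \<epsilon>(2) by simp
  qed
  then show ?thesis by simp
qed

text \<open>
  Bounded coefficients satisfy the degeneracy condition with \<open>\<gamma> = 0\<close> almost everywhere.
\<close>

lemma quadratic_form_le_if_L_infinity:
  fixes C :: "real ^ 'n::finite \<Rightarrow> real ^ 'n ^ 'n"
  assumes "\<And>i j. (\<lambda>x. C x $ i $ j) \<in> L_infinity \<Omega>"
  obtains a where "0 < a" "AE x in lebesgue. x \<in> \<Omega> \<longrightarrow> (\<forall>v. v \<bullet> (C x *v v) \<le> a * (v \<bullet> v))"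
proof -
  define bound where "bound i j m \<longleftrightarrow> (AE x in lebesgue. x \<in> \<Omega> \<longrightarrow> \<bar>C x $ i $ j\<bar> \<le> m)" for i j m
  have "\<forall>i j. \<exists>m. bound i j m"
    using assms by (simp add: L_infinity_def bound_def)
  then obtain M where "\<And>i j. bound i j (M i j)" by metis
  then have M: "\<And>i j. AE x in lebesgue. x \<in> \<Omega> \<longrightarrow> \<bar>C x $ i $ j\<bar> \<le> M i j"
    by (simp only: bound_def)
  define a where "a = 1 + (\<Sum>i\<in>UNIV. \<Sum>j\<in>UNIV. \<bar>M i j\<bar>)"
  have "0 < a" unfolding a_def by (intro add_pos_nonneg sum_nonneg) auto
  have "AE x in lebesgue. \<forall>i\<in>UNIV. \<forall>j\<in>UNIV. x \<in> \<Omega> \<longrightarrow> \<bar>C x $ i $ j\<bar> \<le> M i j"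
    by (intro AE_finite_allI finite_class.finite_UNIV M)
  then have "AE x in lebesgue. x \<in> \<Omega> \<longrightarrow> (\<forall>v. v \<bullet> (C x *v v) \<le> a * (v \<bullet> v))"
  proof eventually_elim
    case (elim x)
    show ?case
    proof (intro impI allI)
      fix v assume "x \<in> \<Omega>"
      have "v \<bullet> (C x *v v) = (\<Sum>i\<in>UNIV. \<Sum>j\<in>UNIV. C x $ i $ j * v $ i * v $ j)"
        by (rule quadratic_form_eq[symmetric])
      also have "\<dots> \<le> (\<Sum>i\<in>UNIV. \<Sum>j\<in>UNIV. \<bar>M i j\<bar> * (v \<bullet> v))"
      proof (intro sum_mono)
        fix i j
        have "C x $ i $ j * v $ i * v $ j \<le> \<bar>C x $ i $ j\<bar> * (\<bar>v $ i\<bar> * \<bar>v $ j\<bar>)"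
          by (metis abs_ge_self abs_mult mult.assoc)
        also have "\<dots> \<le> \<bar>M i j\<bar> * (norm v * norm v)"
          using elim \<open>x \<in> \<Omega>\<close> component_le_norm_cart[of v]
          by (intro mult_mono) (auto intro: order_trans[OF _ abs_ge_self])
        finally show "C x $ i $ j * v $ i * v $ j \<le> \<bar>M i j\<bar> * (v \<bullet> v)"
          by (simp add: power2_norm_eq_inner flip: power2_eq_square)
      qed
      also have "\<dots> = (\<Sum>i\<in>UNIV. \<Sum>j\<in>UNIV. \<bar>M i j\<bar>) * (v \<bullet> v)"
        by (simp add: sum_distrib_right)
      also have "\<dots> \<le> a * (v \<bullet> v)" by (intro mult_right_mono) (auto simp: a_def)
      finally show "v \<bullet> (C x *v v) \<le> a * (v \<bullet> v)" .
    qed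
  qed
  with \<open>0 < a\<close> show ?thesis by (rule that)
qed

theorem proposition4p3:
  fixes \<Omega> A :: "(real ^ 'n::finite) set"
    and C :: "real ^ 'n \<Rightarrow> real ^ 'n ^ 'n"
  assumes "open \<Omega>"
    and "\<And>i j. (\<lambda>x. C x $ i $ j) \<in> W1_infinity \<Omega>"
    and "\<And>i j x. x \<in> \<Omega> \<Longrightarrow> C x $ i $ j = C x $ j $ i"
    and "\<And>x v. x \<in> \<Omega> \<Longrightarrow> v \<noteq> 0 \<Longrightarrow> 0 < v \<bullet> (C x *v v)"
    and "A \<subseteq> closure \<Omega>"
    and "A \<in> sets lebesgue"
    and "emeasure lebesgue A = 0"
  shows "(\<forall>a \<gamma>. 0 < a \<longrightarrow> 0 \<le> \<gamma> \<longrightarrow>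
      (\<forall>x\<in>\<Omega>. \<forall>v. v \<bullet> (C x *v v) \<le> a * degeneracy_weight A \<gamma> x * (v \<bullet> v)) \<longrightarrow>
      \<gamma> \<ge> 2 - (real CARD('n) - set_dimension A) \<longrightarrow>
      (\<gamma> = 2 - (real CARD('n) - set_dimension A) \<longrightarrow> dimension_attained A) \<longrightarrow>
      cap \<Omega> C A = 0) \<and>
    (set_dimension A \<le> real CARD('n) - 2 \<longrightarrow>
      (set_dimension A = real CARD('n) - 2 \<longrightarrow> dimension_attained A) \<longrightarrow>
      cap \<Omega> C A = 0)"
proof (intro conjI allI impI)
  fix a \<gamma> :: real
  assume "0 < a" "0 \<le> \<gamma>"
    and "\<forall>x\<in>\<Omega>. \<forall>v. v \<bullet> (C x *v v) \<le> a * degeneracy_weight A \<gamma> x * (v \<bullet> v)"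
    and "\<gamma> \<ge> 2 - (real CARD('n) - set_dimension A)"
    and "\<gamma> = 2 - (real CARD('n) - set_dimension A) \<longrightarrow> dimension_attained A"
  then show "cap \<Omega> C A = 0"
    using assms(1,4,6) by (intro cap_eq_0_if_degenerate[where a = a and \<gamma> = \<gamma>]) auto
next
  assume dim: "set_dimension A \<le> real CARD('n) - 2"
    and attained: "set_dimension A = real CARD('n) - 2 \<longrightarrow> dimension_attained A"
  have "(\<lambda>x. C x $ i $ j) \<in> L_infinity \<Omega>" for i j
    using assms(2)[of i j] by (simp add: W1_infinity_def)
  then obtain a where "0 < a" "AE x in lebesgue. x \<in> \<Omega> \<longrightarrow> (\<forall>v. v \<bullet> (C x *v v) \<le> a * (v \<bullet> v))"
    by (rule quadratic_form_le_if_L_infinity)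
  then show "cap \<Omega> C A = 0"
    using assms(1,4,6) dim attained
    by (intro cap_eq_0_if_degenerate[where a = a and \<gamma> = 0]) (auto simp: degeneracy_weight_def)
qed

end
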